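(* Let $H$ be a quasi-Hopf $*$-algebra over $\mathbb{C}$ with $*$-canonical element $\Omega$, and let $F\in H\otimes H$ be an arbitrary twist. Then the twisted quasi-Hopf algebra $H_F$ (with the same conjugation $\dagger$) is a quasi-Hopf $*$-algebra with $*$-canonical element $\Omega_F=(F^\dagger)^{-1}\Omega F^{-1}$. If $H$ is self-conjugate (i.e. $\Omega^\dagger=\Omega$), then so is $H_F$ (i.e. $\Omega_F^\dagger=\Omega_F$). Moreover, if the antipode $S$ is $*$-compatible, then it is $*$-compatible for the twisted structure.
   Context: Base field $\mathbb{C}$; $1$ also denotes the identity map; $m$ is multiplication. A conjugation operation on an algebra $H$ is an antilinear map $\dagger:H\to H$ with $(a^\dagger)^\dagger=a$, $(ab)^\dagger=b^\dagger a^\dagger$; it is extended to tensor powers by $(a\otimes b)^\dagger=a^\dagger\otimes b^\dagger$, etc. A quasi-Hopf algebra (QHA) is a unital associative algebra $H$ with algebra homomorphisms $\varepsilon:H\to\mathbb{C}$, $\Delta:H\to H\otimes H$, an invertible $\Phi\in H^{\otimes3}$ (co-associator; write $\Phi=\sum_\nu X_\nu\otimes Y_\nu\otimes Z_\nu$, $\Phi^{-1}=\sum_\nu\bar X_\nu\otimes\bar Y_\nu\otimes\bar Z_\nu$), a bijective algebra anti-homomorphism $S:H\to H$ and $\alpha,\beta\in H$ such that: $(\varepsilon\otimes1)\Delta=1=(1\otimes\varepsilon)\Delta$; $(1\otimes\Delta)\Delta(a)=\Phi^{-1}(\Delta\otimes1)\Delta(a)\Phi$; $(\Delta\otimes1\otimes1)\Phi\cdot(1\otimes1\otimes\Delta)\Phi=(\Phi\otimes1)\cdot(1\otimes\Delta\otimes1)\Phi\cdot(1\otimes\Phi)$;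 $(1\otimes\varepsilon\otimes1)\Phi=1$; $\sum_\nu S(X_\nu)\alpha Y_\nu\beta S(Z_\nu)=1=\sum_\nu\bar X_\nu\beta S(\bar Y_\nu)\alpha\bar Z_\nu$; $\sum S(a_{(1)})\alpha a_{(2)}=\varepsilon(a)\alpha$ and $\sum a_{(1)}\beta S(a_{(2)})=\varepsilon(a)\beta$ for all $a$. A twist is an invertible $F\in H\otimes H$ with $(\varepsilon\otimes1)F=(1\otimes\varepsilon)F=1$. Twisting a QHA $H$ by $F$ gives the QHA $H_F$ with the same algebra, $\varepsilon$, $S$ and $\Delta_F(a)=F\Delta(a)F^{-1}$, $\Phi_F=(F\otimes1)(\Delta\otimes1)(F)\,\Phi\,(1\otimes\Delta)(F^{-1})(1\otimes F^{-1})$, $\alpha_F=m(1\otimes\alpha)(S\otimes1)F^{-1}$, $\beta_F=m(1\otimes\beta)(1\otimes S)F$. A quasi-Hopf $*$-algebra ($*$-QHA) is a QHA $H$ with a conjugation operation $\dagger$ and a twist $\Omega$ (the $*$-canonical element) with $\varepsilon(a^\dagger)=\overline{\varepsilon(a)}$, $\Delta(a)^\dagger=\Omega\Delta(a^\dagger)\Omega^{-1}$ for all $a$, and $(\Phi^\dagger)^{-1}=\Phi_\Omega$. The antipode is called $*$-compatible if $S(a)^\dagger=S^{-1}(a^\dagger)$ for all $a\in H$. *)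

theory Defs
  imports Complex_Main "HOL-Library.Poly_Mapping"
begin

section \<open>Complex vector spaces and complex algebras\<close>

class scaleC =
  fixes scaleC :: "complex \<Rightarrow> 'a \<Rightarrow> 'a"  (infixr \<open>*\<^sub>C\<close> 75)

class complex_vector = scaleC + ab_group_add +
  assumes scaleC_add_right: "c *\<^sub>C (x + y) = c *\<^sub>C x + c *\<^sub>C y"
    and scaleC_add_left: "(c + d) *\<^sub>C x = c *\<^sub>C x + d *\<^sub>C x"
    and scaleC_scaleC: "c *\<^sub>C d *\<^sub>C x = (c * d) *\<^sub>C x"
    and scaleC_one: "1 *\<^sub>C x = x"

class complex_algebra_1 = complex_vector + ring_1 +
  assumes mult_scaleC_left: "(c *\<^sub>C x) * y = c *\<^sub>C (x * y)"
    and mult_scaleC_right: "x * (c *\<^sub>C y) = c *\<^sub>C (x * y)"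

global_interpretation complex_vector:
    vector_space "scaleC :: complex \<Rightarrow> 'a \<Rightarrow> 'a::complex_vector"
  by standard (simp_all add: scaleC_add_right scaleC_add_left scaleC_scaleC scaleC_one)

instantiation complex :: complex_algebra_1
begin

definition scaleC_complex :: "complex \<Rightarrow> complex \<Rightarrow> complex" where
  "scaleC_complex c z = c * z"

instance
  by standard (simp_all add: scaleC_complex_def algebra_simps)

end

abbreviation clinear :: "('a::complex_vector \<Rightarrow> 'b::complex_vector) \<Rightarrow> bool" where
  "clinear \<equiv> Vector_Spaces.linear scaleC scaleC"

definition antilinear :: "('a::complex_vector \<Rightarrow> 'b::complex_vector) \<Rightarrow> bool" where
  "antilinear f \<longleftrightarrow>
     (\<forall>x y. f (x + y) = f x + f y) \<and> (\<forall>c x. f (c *\<^sub>C x) = cnj c *\<^sub>C f x)"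

definition algebra_hom :: "('a::complex_algebra_1 \<Rightarrow> 'b::complex_algebra_1) \<Rightarrow> bool" where
  "algebra_hom f \<longleftrightarrow> clinear f \<and> f 1 = 1 \<and> (\<forall>x y. f (x * y) = f x * f y)"

definition algebra_antihom :: "('a::complex_algebra_1 \<Rightarrow> 'b::complex_algebra_1) \<Rightarrow> bool" where
  "algebra_antihom f \<longleftrightarrow> clinear f \<and> f 1 = 1 \<and> (\<forall>x y. f (x * y) = f y * f x)"

definition invertible_elem :: "'a::monoid_mult \<Rightarrow> bool" where
  "invertible_elem x \<longleftrightarrow> (\<exists>y. x * y = 1 \<and> y * x = 1)"

definition inv_elem :: "'a::monoid_mult \<Rightarrow> 'a" where
  "inv_elem x = (THE y. x * y = 1 \<and> y * x = 1)"

lemma inv_elem_eqI: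
  assumes "x * y = 1" "y * x = 1"
  shows "inv_elem x = y"
  unfolding inv_elem_def
proof (rule the_equality)
  fix z assume "x * z = 1 \<and> z * x = 1"
  then have "z = z * (x * y)" using assms by simp
  also have "\<dots> = y" using \<open>x * z = 1 \<and> z * x = 1\<close> by (simp add: mult.assoc [symmetric])
  finally show "z = y" .
qed (use assms in simp)


section \<open>The algebraic tensor product over the complex numbers\<close>

definition free_scale :: "complex \<Rightarrow> ('k \<Rightarrow>\<^sub>0 complex) \<Rightarrow> ('k \<Rightarrow>\<^sub>0 complex)" where
  "free_scale c p = Poly_Mapping.map ((*) c) p"

lemma lookup_free_scale [simp]:
  "Poly_Mapping.lookup (free_scale c p) k = c * Poly_Mapping.lookup p k"
  unfolding free_scale_def by transfer (simp add: when_def)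

global_interpretation free: vector_space "free_scale :: complex \<Rightarrow> ('k \<Rightarrow>\<^sub>0 complex) \<Rightarrow> _"
  by standard (auto intro!: poly_mapping_eqI simp: lookup_add algebra_simps)

lemma free_scale_single [simp]:
  "free_scale c (Poly_Mapping.single k d) = Poly_Mapping.single k (c * d)"
  by (rule poly_mapping_eqI) (simp add: lookup_single when_def)

inductive_set tensor_relators ::
    "('a::complex_vector \<times> 'b::complex_vector \<Rightarrow>\<^sub>0 complex) set" where
  add_left: "Poly_Mapping.single (a + a', b) 1 -
    (Poly_Mapping.single (a, b) 1 + Poly_Mapping.single (a', b) 1) \<in> tensor_relators"
| add_right: "Poly_Mapping.single (a, b + b') 1 -
    (Poly_Mapping.single (a, b) 1 + Poly_Mapping.single (a, b') 1) \<in> tensor_relators"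
| scale_left: "Poly_Mapping.single (c *\<^sub>C a, b) 1 -
    free_scale c (Poly_Mapping.single (a, b) 1) \<in> tensor_relators"
| scale_right: "Poly_Mapping.single (a, c *\<^sub>C b) 1 -
    free_scale c (Poly_Mapping.single (a, b) 1) \<in> tensor_relators"

quotient_type (overloaded) ('a, 'b) tensor =
  "'a::complex_vector \<times> 'b::complex_vector \<Rightarrow>\<^sub>0 complex" /
  "\<lambda>p q. p - q \<in> free.span tensor_relators"
proof (rule equivpI)
  let ?R = "\<lambda>p q :: 'a \<times> 'b \<Rightarrow>\<^sub>0 complex. p - q \<in> free.span tensor_relators"
  show "reflp ?R"
    by (rule reflpI) (simp add: free.span_zero)
  show "symp ?R"
  proof (rule sympI)
    fix p q assume "?R p q"
    then have "- (p - q) \<in> free.span tensor_relators" by (rule free.span_neg)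
    then show "?R q p" by simp
  qed
  show "transp ?R"
  proof (rule transpI)
    fix p q r assume "?R p q" "?R q r"
    then have "(p - q) + (q - r) \<in> free.span tensor_relators" by (rule free.span_add)
    then show "?R p r" by simp
  qed
qed

type_notation tensor (infixr \<open>\<otimes>\<close> 70)

instantiation tensor :: (complex_vector, complex_vector) complex_vector
begin

lift_definition zero_tensor :: "'a \<otimes> 'b" is "0" .

lift_definition plus_tensor :: "'a \<otimes> 'b \<Rightarrow> 'a \<otimes> 'b \<Rightarrow> 'a \<otimes> 'b" is "(+)"
  unfolding add_diff_add by (rule free.span_add)

lift_definition uminus_tensor :: "'a \<otimes> 'b \<Rightarrow> 'a \<otimes> 'b" is "uminus"
  unfolding minus_diff_minus by (rule free.span_neg)

lift_definition minus_tensor :: "'a \<otimes> 'b \<Rightarrow> 'a \<otimes> 'b \<Rightarrow> 'a \<otimes> 'b" is "(-)"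
  unfolding diff_diff_eq2 diff_conv_add_uminus minus_add_distrib minus_minus
  by (drule (1) free.span_diff) (simp add: algebra_simps)

lift_definition scaleC_tensor :: "complex \<Rightarrow> 'a \<otimes> 'b \<Rightarrow> 'a \<otimes> 'b" is free_scale
  unfolding free.scale_right_diff_distrib [symmetric] by (rule free.span_scale)

instance
proof
  fix x y z :: "'a \<otimes> 'b" and c d :: complex
  show "x + y + z = x + (y + z)" by transfer (simp add: add.assoc free.span_zero)
  show "x + y = y + x" by transfer (simp add: add.commute free.span_zero)
  show "0 + x = x" by transfer (simp add: free.span_zero)
  show "- x + x = 0" by transfer (simp add: free.span_zero)
  show "x - y = x + - y" by transfer (simp add: free.span_zero)
  show "c *\<^sub>C (x + y) = c *\<^sub>C x + c *\<^sub>C y"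
    by transfer (simp add: free.scale_right_distrib free.span_zero)
  show "(c + d) *\<^sub>C x = c *\<^sub>C x + d *\<^sub>C x"
    by transfer (simp add: free.scale_left_distrib free.span_zero)
  show "c *\<^sub>C d *\<^sub>C x = (c * d) *\<^sub>C x"
    by transfer (simp add: free.span_zero)
  show "1 *\<^sub>C x = x"
    by transfer (simp add: free.span_zero)
qed

end

lift_definition tensor :: "'a::complex_vector \<Rightarrow> 'b::complex_vector \<Rightarrow> 'a \<otimes> 'b"  (infixr \<open>\<otimes>\<close> 72)
  is "\<lambda>a b. Poly_Mapping.single (a, b) 1" .

lemma tensor_add_left: "(a + a') \<otimes> b = a \<otimes> b + a' \<otimes> b"
  by transfer (rule free.span_base, rule tensor_relators.add_left)

lemma tensor_add_right: "a \<otimes> (b + b') = a \<otimes> b + a \<otimes> b'"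
  by transfer (rule free.span_base, rule tensor_relators.add_right)

lemma tensor_scaleC_left: "(c *\<^sub>C a) \<otimes> b = c *\<^sub>C (a \<otimes> b)"
  by transfer (rule free.span_base, rule tensor_relators.scale_left)

lemma tensor_scaleC_right: "a \<otimes> (c *\<^sub>C b) = c *\<^sub>C (a \<otimes> b)"
  by transfer (rule free.span_base, rule tensor_relators.scale_right)

lemma tensor_induct [case_names tensor add, induct type: tensor]:
  fixes t :: "'a::complex_vector \<otimes> 'b::complex_vector"
  assumes tensor: "\<And>a b. P (a \<otimes> b)"
    and add: "\<And>x y. P x \<Longrightarrow> P y \<Longrightarrow> P (x + y)"
  shows "P t"
proof (rule tensor.abs_induct)
  fix p :: "'a \<times> 'b \<Rightarrow>\<^sub>0 complex"
  show "P (abs_tensor p)"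
  proof (induct p rule: update_induct)
    case const
    have "(0 :: 'a) \<otimes> (0 :: 'b) = 0"
      using tensor_scaleC_left [of 0 "0 :: 'a" "0 :: 'b"] by simp
    then show ?case using tensor [of 0 0] by (simp add: zero_tensor_def)
  next
    case (update p k c)
    obtain a b where k: "k = (a, b)" by (cases k)
    have "Poly_Mapping.update k c p = p + free_scale c (Poly_Mapping.single k 1)"
      using update(1)
      by (intro poly_mapping_eqI)
        (auto simp: lookup_update lookup_add lookup_single when_def in_keys_iff)
    then have "abs_tensor (Poly_Mapping.update k c p) = abs_tensor p + c *\<^sub>C (a \<otimes> b)"
      unfolding k by (simp only: plus_tensor.abs_eq scaleC_tensor.abs_eq tensor.abs_eq)
    then have "abs_tensor (Poly_Mapping.update k c p) = abs_tensor p + (c *\<^sub>C a) \<otimes> b"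
      by (simp only: tensor_scaleC_left)
    then show ?case using add [OF update(3) tensor] by simp
  qed
qed

text \<open>
  A biadditive map \<open>g\<close> that is balanced over the scalars factors through the tensor product as an
  additive map.  Asking only for balancedness, instead of bilinearity, lets the same operation
  extend linear and antilinear maps.
\<close>

definition balanced ::
  "('a::complex_vector \<Rightarrow> 'b::complex_vector \<Rightarrow> 'c::ab_group_add) \<Rightarrow> bool" where
  "balanced g \<longleftrightarrow>
     (\<forall>a a' b. g (a + a') b = g a b + g a' b) \<and>
     (\<forall>a b b'. g a (b + b') = g a b + g a b') \<and>
     (\<forall>c a b. g (c *\<^sub>C a) b = g a (c *\<^sub>C b))"

definition tensor_lift ::
  "('a::complex_vector \<Rightarrow> 'b::complex_vector \<Rightarrow> 'c::ab_group_add) \<Rightarrow> 'a \<otimes> 'b \<Rightarrow> 'c" where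
  "tensor_lift g = (THE h. additive h \<and> (\<forall>a b. h (a \<otimes> b) = g a b))"

lemma additive_tensor_eqI:
  fixes h h' :: "'a::complex_vector \<otimes> 'b::complex_vector \<Rightarrow> 'c::ab_group_add"
  assumes "additive h" "additive h'" "\<And>a b. h (a \<otimes> b) = h' (a \<otimes> b)"
  shows "h t = h' t"
  by (induct t) (simp_all add: assms additive.add)

lemma tensor_lift_exists:
  fixes g :: "'a::complex_vector \<Rightarrow> 'b::complex_vector \<Rightarrow> 'c::ab_group_add"
  assumes "balanced g"
  shows "\<exists>h. additive h \<and> (\<forall>a b. h (a \<otimes> b) = g a b)"
proof -
  have addl: "g (a + a') b = g a b + g a' b"
    and addr: "g a (b + b') = g a b + g a b'"
    and bal: "g (c *\<^sub>C a) b = g a (c *\<^sub>C b)" for a a' b b' c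
    using assms by (auto simp: balanced_def)
  have g0: "g 0 b = 0" for b using addl [of 0 0 b] by simp
  define L where "L p = (\<Sum>k\<in>Poly_Mapping.keys p. g (Poly_Mapping.lookup p k *\<^sub>C fst k) (snd k))"
    for p :: "'a \<times> 'b \<Rightarrow>\<^sub>0 complex"
  have L_add: "L (p + q) = L p + L q" for p q
    unfolding L_def
    by (rule setsum_keys_plus_distrib) (simp_all add: g0 complex_vector.scale_left_distrib addl)
  then have "additive L" by (simp add: additive_def)
  then interpret L: additive L .
  have L_single: "L (Poly_Mapping.single k c) = g (c *\<^sub>C fst k) (snd k)" for k c
    by (cases "c = 0") (simp_all add: L_def g0)
  have "\<forall>c. L (free_scale c p) = 0" if "p \<in> free.span tensor_relators" for p
    using that
  proof (induct p rule: free.span_induct)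
    case base
    show ?case
      by (rule free.subspaceI) (simp_all add: free.scale_right_distrib L.zero L_add)
  next
    case (step p)
    then show ?case
      by cases (simp_all add: free.scale_right_diff_distrib free.scale_right_distrib L.diff L_add
          L_single complex_vector.scale_right_distrib addl addr bal [symmetric] mult.commute)
  qed
  note L_span = this
  have L_rel: "L p = L q" if "p - q \<in> free.span tensor_relators" for p q
    using L_span [OF that, THEN spec, of 1] by (simp add: L.diff)
  define h where "h t = L (rep_tensor t)" for t
  have h_abs: "h (abs_tensor p) = L p" for p
    unfolding h_def by (rule L_rel) (rule Quotient3_rep_abs [OF Quotient3_tensor], simp add: free.span_zero)
  have "h (x + y) = h x + h y" for x y
    by (rule tensor.abs_induct [of _ x], rule tensor.abs_induct [of _ y])
      (simp add: plus_tensor.abs_eq h_abs L_add)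
  moreover have "h (a \<otimes> b) = g a b" for a b
    by (simp add: tensor.abs_eq h_abs L_single)
  ultimately show ?thesis by (auto simp: additive_def)
qed

lemma tensor_lift:
  assumes "balanced g"
  shows "additive (tensor_lift g)" and "tensor_lift g (a \<otimes> b) = g a b"
proof -
  obtain h where h: "additive h \<and> (\<forall>a b. h (a \<otimes> b) = g a b)"
    using tensor_lift_exists [OF assms] ..
  have "\<exists>!h. additive h \<and> (\<forall>a b. h (a \<otimes> b) = g a b)"
  proof (rule ex1I [of _ h])
    show "additive h \<and> (\<forall>a b. h (a \<otimes> b) = g a b)" by (rule h)
  next
    fix h' assume h': "additive h' \<and> (\<forall>a b. h' (a \<otimes> b) = g a b)"
    show "h' = h"
      by (rule ext, rule additive_tensor_eqI) (simp_all add: h h')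
  qed
  from theI' [OF this] show "additive (tensor_lift g)" "tensor_lift g (a \<otimes> b) = g a b"
    by (simp_all add: tensor_lift_def)
qed

lemma tensor_lift_add: "balanced g \<Longrightarrow> tensor_lift g (x + y) = tensor_lift g x + tensor_lift g y"
  using tensor_lift(1) by (rule additive.add)

definition tensor_map ::
  "('a::complex_vector \<Rightarrow> 'c::complex_vector) \<Rightarrow> ('b::complex_vector \<Rightarrow> 'd::complex_vector)
    \<Rightarrow> 'a \<otimes> 'b \<Rightarrow> 'c \<otimes> 'd" where
  "tensor_map f g = tensor_lift (\<lambda>a b. f a \<otimes> g b)"

lemma tensor_map_linear:
  assumes "clinear f" "clinear g"
  shows "tensor_map f g (a \<otimes> b) = f a \<otimes> g b"
  using assms unfolding tensor_map_def
  by (intro tensor_lift)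
    (auto simp: balanced_def Vector_Spaces.linear_iff tensor_add_left tensor_add_right
      tensor_scaleC_left tensor_scaleC_right)

lemma tensor_map_antilinear:
  assumes "antilinear f" "antilinear g"
  shows "tensor_map f g (a \<otimes> b) = f a \<otimes> g b"
  using assms unfolding tensor_map_def
  by (intro tensor_lift)
    (auto simp: balanced_def antilinear_def tensor_add_left tensor_add_right
      tensor_scaleC_left tensor_scaleC_right)

definition tensor_assoc ::
  "('a::complex_vector \<otimes> 'b::complex_vector) \<otimes> 'c::complex_vector \<Rightarrow> 'a \<otimes> ('b \<otimes> 'c)" where
  "tensor_assoc = tensor_lift (\<lambda>ab c. tensor_lift (\<lambda>a b. a \<otimes> (b \<otimes> c)) ab)"

lemma tensor_assoc_tensor:
  fixes a :: "'a::complex_vector" and b :: "'b::complex_vector" and c :: "'c::complex_vector"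
  shows "tensor_assoc ((a \<otimes> b) \<otimes> c) = a \<otimes> (b \<otimes> c)"
proof -
  define g where "g c a b = a \<otimes> (b \<otimes> c)" for a :: 'a and b :: 'b and c :: 'c
  have bal: "balanced (g c)" for c
    by (simp add: balanced_def g_def tensor_add_left tensor_add_right tensor_scaleC_left
        tensor_scaleC_right)
  have g_add: "tensor_lift (g (c + c')) ab = tensor_lift (g c) ab + tensor_lift (g c') ab"
    for c c' ab
    by (induct ab) (simp_all add: tensor_lift_add tensor_lift(2) bal,
        simp add: g_def tensor_add_right)
  have scale: "tensor_lift (g c) (d *\<^sub>C ab) = tensor_lift (g (d *\<^sub>C c)) ab" for c d ab
  proof (induct ab)
    case (tensor a b)
    have "tensor_lift (g c) (d *\<^sub>C (a \<otimes> b)) = g c (d *\<^sub>C a) b"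
      by (simp only: tensor_scaleC_left [symmetric] tensor_lift(2) bal)
    then show ?case
      by (simp add: tensor_lift(2) bal) (simp add: g_def tensor_scaleC_left tensor_scaleC_right)
  next
    case (add x y)
    then show ?case by (simp add: tensor_lift_add bal complex_vector.scale_right_distrib)
  qed
  have "balanced (\<lambda>ab c. tensor_lift (g c) ab)" (is "balanced ?h")
    unfolding balanced_def by (simp add: tensor_lift_add bal g_add scale)
  then have "tensor_lift ?h ((a \<otimes> b) \<otimes> c) = tensor_lift (g c) (a \<otimes> b)"
    by (rule tensor_lift(2))
  also have "\<dots> = g c a b"
    by (rule tensor_lift(2) [OF bal])
  finally show ?thesis
    by (simp add: tensor_assoc_def g_def [abs_def])
qed

lemma tensor_eq_0_iff: "a \<otimes> b = 0 \<longleftrightarrow> a = 0 \<or> b = 0"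
proof
  assume 0: "a \<otimes> b = 0"
  show "a = 0 \<or> b = 0"
  proof (rule ccontr)
    assume "\<not> (a = 0 \<or> b = 0)"
    have functional: "\<exists>f. clinear f \<and> f x = (1 :: complex)" if "x \<noteq> 0" for x :: "'c::complex_vector"
    proof -
      interpret vector_space_pair "scaleC :: _ \<Rightarrow> 'c \<Rightarrow> 'c" "scaleC :: _ \<Rightarrow> complex \<Rightarrow> complex" ..
      have "complex_vector.independent {x}" using that by simp
      then show ?thesis
        using linear_construct [of "{x}" "\<lambda>_. 1"] construct_basis [of "{x}" x "\<lambda>_. 1"] by blast
    qed
    from \<open>\<not> (a = 0 \<or> b = 0)\<close> functional obtain f :: "'a \<Rightarrow> complex" and g :: "'b \<Rightarrow> complex"
      where f: "clinear f" "f a = 1" and g: "clinear g" "g b = 1" by meson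
    have bal: "balanced (\<lambda>a b. f a * g b)"
      using f(1) g(1)
      by (simp add: balanced_def Vector_Spaces.linear_iff algebra_simps scaleC_complex_def)
    have "tensor_lift (\<lambda>a b. f a * g b) (a \<otimes> b) = 1" using f g by (simp add: tensor_lift(2) bal)
    with 0 show False using additive.zero [OF tensor_lift(1) [OF bal]] by simp
  qed
next
  show "a = 0 \<or> b = 0 \<Longrightarrow> a \<otimes> b = 0"
    using tensor_scaleC_left [of 0 a b] tensor_scaleC_right [of a 0 b] by auto
qed

instantiation tensor :: (complex_algebra_1, complex_algebra_1) complex_algebra_1
begin

definition one_tensor :: "'a \<otimes> 'b" where
  "one_tensor = 1 \<otimes> 1"

text \<open>Left multiplication by the simple tensor \<open>a \<otimes> b\<close>.\<close>

definition simple_times :: "'a \<Rightarrow> 'b \<Rightarrow> 'a \<otimes> 'b \<Rightarrow> 'a \<otimes> 'b" where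
  "simple_times a b = tensor_lift (\<lambda>a' b'. (a * a') \<otimes> (b * b'))"

definition times_tensor :: "'a \<otimes> 'b \<Rightarrow> 'a \<otimes> 'b \<Rightarrow> 'a \<otimes> 'b" where
  "times_tensor x y = tensor_lift (\<lambda>a b. simple_times a b y) x"

lemma balanced_times: "balanced (\<lambda>a' b'. ((a::'a) * a') \<otimes> ((b::'b) * b'))"
  by (simp add: balanced_def tensor_add_left tensor_add_right tensor_scaleC_left
      tensor_scaleC_right distrib_left mult_scaleC_right)

lemma simple_times_tensor: "simple_times a b (a' \<otimes> b') = (a * a') \<otimes> ((b::'b) * b')" for a :: 'a
  unfolding simple_times_def by (rule tensor_lift(2) [OF balanced_times])

lemma simple_times_add: "simple_times a b (x + y) = simple_times a b x + simple_times a b y"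
  for a :: 'a and b :: 'b
  unfolding simple_times_def by (rule tensor_lift_add [OF balanced_times])

lemma balanced_simple_times: "balanced (\<lambda>(a::'a) (b::'b). simple_times a b y)"
proof (induct y)
  case (tensor a b)
  show ?case
    by (simp add: balanced_def simple_times_tensor distrib_right tensor_add_left
        tensor_add_right tensor_scaleC_left tensor_scaleC_right mult_scaleC_left)
next
  case (add x y)
  then show ?case by (simp add: balanced_def simple_times_add)
qed

lemma tensor_times_simple: "(a \<otimes> b) * y = simple_times a b y" for a :: 'a and b :: 'b
  unfolding times_tensor_def by (rule tensor_lift(2) [OF balanced_simple_times])

lemma tensor_times_tensor: "(a \<otimes> b) * (a' \<otimes> b') = (a * a') \<otimes> ((b :: 'b) * b')" for a :: 'a
  by (simp add: tensor_times_simple simple_times_tensor)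

lemma tensor_distrib_right: "(x + y) * z = x * z + y * z" for x :: "'a \<otimes> 'b"
  unfolding times_tensor_def by (rule tensor_lift_add [OF balanced_simple_times])

lemma tensor_distrib_left: "x * (y + z) = x * y + x * z" for x :: "'a \<otimes> 'b"
  by (induct x) (simp_all add: tensor_times_simple simple_times_add tensor_distrib_right)

instance
proof
  fix x y z :: "'a \<otimes> 'b" and c :: complex
  have 1: "(a \<otimes> b) * (a' \<otimes> b') * z = (a \<otimes> b) * ((a' \<otimes> b') * z)" for a a' :: 'a and b b' :: 'b
    by (induct z) (simp_all add: tensor_times_tensor tensor_distrib_left mult.assoc)
  have 2: "(a \<otimes> b) * y * z = (a \<otimes> b) * (y * z)" for a :: 'a and b :: 'b
    by (induct y) (simp_all add: 1 tensor_distrib_left tensor_distrib_right)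
  show "x * y * z = x * (y * z)"
    by (induct x) (simp_all add: 2 tensor_distrib_left tensor_distrib_right)
  show "1 * x = x"
    by (induct x) (simp_all add: one_tensor_def tensor_times_tensor tensor_distrib_left)
  show "x * 1 = x"
    by (induct x) (simp_all add: one_tensor_def tensor_times_tensor tensor_distrib_right)
  show "(x + y) * z = x * z + y * z" by (rule tensor_distrib_right)
  show "x * (y + z) = x * y + x * z" by (rule tensor_distrib_left)
  show "(0 :: 'a \<otimes> 'b) \<noteq> 1" by (metis one_tensor_def tensor_eq_0_iff zero_neq_one)
  have 3: "(c *\<^sub>C (a \<otimes> b)) * y = c *\<^sub>C ((a \<otimes> b) * y)"
    and 4: "(a \<otimes> b) * (c *\<^sub>C y) = c *\<^sub>C ((a \<otimes> b) * y)" for a :: 'a and b :: 'b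
    by (induct y)
      (simp_all add: tensor_scaleC_left [symmetric] tensor_times_tensor mult_scaleC_left
        mult_scaleC_right tensor_distrib_left complex_vector.scale_right_distrib)
  show "(c *\<^sub>C x) * y = c *\<^sub>C (x * y)"
    by (induct x) (simp_all add: 3 tensor_distrib_right complex_vector.scale_right_distrib)
  show "x * (c *\<^sub>C y) = c *\<^sub>C (x * y)"
    by (induct x) (simp_all add: 4 tensor_distrib_right complex_vector.scale_right_distrib)
qed

end


section \<open>Quasi-Hopf algebras\<close>

text \<open>
  Tensor powers are bracketed to the right: \<open>'a \<otimes> 'a \<otimes> 'a\<close> is \<open>'a \<otimes> ('a \<otimes> 'a)\<close>.  The
  rebracketing isomorphism \<^const>\<open>tensor_assoc\<close> is inserted wherever another bracketing arises.
\<close>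

record (overloaded) 'a quasi_hopf =
  counit :: "'a::complex_algebra_1 \<Rightarrow> complex"
  comult :: "'a \<Rightarrow> 'a \<otimes> 'a"
  coassoc :: "'a \<otimes> 'a \<otimes> 'a"
  antipode :: "'a \<Rightarrow> 'a"
  alpha :: 'a
  beta :: 'a

text \<open>
  The maps \<open>\<epsilon> \<otimes> 1\<close> and \<open>1 \<otimes> \<epsilon>\<close>, with \<open>\<complex> \<otimes> V\<close> and \<open>V \<otimes> \<complex>\<close> identified with \<open>V\<close>.
\<close>

definition counit_left ::
  "('a::complex_vector \<Rightarrow> complex) \<Rightarrow> 'a \<otimes> 'b::complex_vector \<Rightarrow> 'b" where
  "counit_left \<epsilon> = tensor_lift (\<lambda>a b. \<epsilon> a *\<^sub>C b)"

definition counit_right ::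
  "('b::complex_vector \<Rightarrow> complex) \<Rightarrow> 'a::complex_vector \<otimes> 'b \<Rightarrow> 'a" where
  "counit_right \<epsilon> = tensor_lift (\<lambda>a b. \<epsilon> b *\<^sub>C a)"

text \<open>
  \<open>\<Delta> \<otimes> 1\<close> on \<open>'a \<otimes> 'b\<close>; for \<open>'b = 'a \<otimes> 'a\<close> this is \<open>\<Delta> \<otimes> 1 \<otimes> 1\<close>.
\<close>

definition comult_left ::
  "('a::complex_vector \<Rightarrow> 'a \<otimes> 'a) \<Rightarrow> 'a \<otimes> 'b::complex_vector \<Rightarrow> 'a \<otimes> 'a \<otimes> 'b" where
  "comult_left \<Delta> x = tensor_assoc (tensor_map \<Delta> id x)"

definition tensor_lift3 ::
  "('a::complex_vector \<Rightarrow> 'b::complex_vector \<Rightarrow> 'c::complex_vector \<Rightarrow> 'd::ab_group_add)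
    \<Rightarrow> 'a \<otimes> 'b \<otimes> 'c \<Rightarrow> 'd" where
  "tensor_lift3 f = tensor_lift (\<lambda>x. tensor_lift (f x))"

locale quasi_hopf_algebra =
  fixes H :: "'a::complex_algebra_1 quasi_hopf"
  assumes counit_hom: "algebra_hom (counit H)"
    and comult_hom: "algebra_hom (comult H)"
    and coassoc_invertible: "invertible_elem (coassoc H)"
    and antipode_antihom: "algebra_antihom (antipode H)"
    and antipode_bij: "bij (antipode H)"
    and counit_left_comult: "counit_left (counit H) (comult H a) = a"
    and counit_right_comult: "counit_right (counit H) (comult H a) = a"
    and quasi_coassociative:
      "tensor_map id (comult H) (comult H a) =
         inv_elem (coassoc H) * comult_left (comult H) (comult H a) * coassoc H"
    and pentagon:
      "comult_left (comult H) (coassoc H) * tensor_map id (tensor_map id (comult H)) (coassoc H) =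
         tensor_map id tensor_assoc (tensor_assoc (coassoc H \<otimes> 1)) *
         tensor_map id (comult_left (comult H)) (coassoc H) * (1 \<otimes> coassoc H)"
    and counit_coassoc: "tensor_map id (counit_left (counit H)) (coassoc H) = 1"
    and antipode_coassoc:
      "tensor_lift3 (\<lambda>x y z. antipode H x * alpha H * y * beta H * antipode H z) (coassoc H) = 1"
    and antipode_coassoc_inv:
      "tensor_lift3 (\<lambda>x y z. x * beta H * antipode H y * alpha H * z) (inv_elem (coassoc H)) = 1"
    and antipode_alpha:
      "tensor_lift (\<lambda>x y. antipode H x * alpha H * y) (comult H a) = counit H a *\<^sub>C alpha H"
    and antipode_beta:
      "tensor_lift (\<lambda>x y. x * beta H * antipode H y) (comult H a) = counit H a *\<^sub>C beta H"

definition is_twist :: "'a::complex_algebra_1 quasi_hopf \<Rightarrow> 'a \<otimes> 'a \<Rightarrow> bool" where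
  "is_twist H F \<longleftrightarrow>
     invertible_elem F \<and> counit_left (counit H) F = 1 \<and> counit_right (counit H) F = 1"

definition twisted :: "'a::complex_algebra_1 quasi_hopf \<Rightarrow> 'a \<otimes> 'a \<Rightarrow> 'a quasi_hopf" where
  "twisted H F =
     \<lparr>counit = counit H,
      comult = (\<lambda>a. F * comult H a * inv_elem F),
      coassoc = tensor_assoc (F \<otimes> 1) * comult_left (comult H) F * coassoc H *
        tensor_map id (comult H) (inv_elem F) * (1 \<otimes> inv_elem F),
      antipode = antipode H,
      alpha = tensor_lift (*) ((1 \<otimes> alpha H) * tensor_map (antipode H) id (inv_elem F)),
      beta = tensor_lift (*) ((1 \<otimes> beta H) * tensor_map id (antipode H) F)\<rparr>"


section \<open>Quasi-Hopf star-algebras\<close>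

definition conjugation :: "('a::complex_algebra_1 \<Rightarrow> 'a) \<Rightarrow> bool" where
  "conjugation dag \<longleftrightarrow>
     antilinear dag \<and> (\<forall>a. dag (dag a) = a) \<and> (\<forall>a b. dag (a * b) = dag b * dag a)"

definition conj2 :: "('a::complex_vector \<Rightarrow> 'a) \<Rightarrow> 'a \<otimes> 'a \<Rightarrow> 'a \<otimes> 'a" where
  "conj2 dag = tensor_map dag dag"

definition conj3 :: "('a::complex_vector \<Rightarrow> 'a) \<Rightarrow> 'a \<otimes> 'a \<otimes> 'a \<Rightarrow> 'a \<otimes> 'a \<otimes> 'a" where
  "conj3 dag = tensor_map dag (tensor_map dag dag)"

locale quasi_hopf_star_algebra = quasi_hopf_algebra H
  for H :: "'a::complex_algebra_1 quasi_hopf" +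
  fixes dag :: "'a \<Rightarrow> 'a" and \<Omega> :: "'a \<otimes> 'a"
  assumes conjugation: "conjugation dag"
    and canonical_twist: "is_twist H \<Omega>"
    and counit_conj: "counit H (dag a) = cnj (counit H a)"
    and comult_conj: "conj2 dag (comult H a) = \<Omega> * comult H (dag a) * inv_elem \<Omega>"
    and coassoc_conj: "inv_elem (conj3 dag (coassoc H)) = coassoc (twisted H \<Omega>)"

definition self_conjugate :: "('a::complex_algebra_1 \<Rightarrow> 'a) \<Rightarrow> 'a \<otimes> 'a \<Rightarrow> bool" where
  "self_conjugate dag \<Omega> \<longleftrightarrow> conj2 dag \<Omega> = \<Omega>"

definition star_compatible_antipode ::
  "'a::complex_algebra_1 quasi_hopf \<Rightarrow> ('a \<Rightarrow> 'a) \<Rightarrow> bool" where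
  "star_compatible_antipode H dag \<longleftrightarrow> (\<forall>a. dag (antipode H a) = inv (antipode H) (dag a))"

definition twisted_canonical ::
  "('a::complex_algebra_1 \<Rightarrow> 'a) \<Rightarrow> 'a \<otimes> 'a \<Rightarrow> 'a \<otimes> 'a \<Rightarrow> 'a \<otimes> 'a" where
  "twisted_canonical dag \<Omega> F = inv_elem (conj2 dag F) * \<Omega> * inv_elem F"

end

theory Submission
  imports Defs
begin

text \<open>
  Every axiom of the twisted structure follows from the corresponding axiom of \<open>H\<close> by letting
  powers of the twist cancel.  Writing \<open>F\<^sub>1\<^sub>2\<close> and \<open>F\<^sub>2\<^sub>3\<close> for \<open>F\<close> placed on two neighbouring tensor
  legs, one has
  \<open>\<Phi>\<^sub>F = F\<^sub>1\<^sub>2 (\<Delta> \<otimes> 1)(F) \<Phi> (1 \<otimes> \<Delta>)(F)\<^sup>-\<^sup>1 F\<^sub>2\<^sub>3\<^sup>-\<^sup>1\<close>, and applying \<open>\<Delta>\<^sub>F\<close> to one leg of a tensor is applying \<open>\<Delta>\<close> to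
  it and conjugating by the corresponding copy of \<open>F\<close>.

  In the pentagon for \<open>\<Phi>\<^sub>F\<close> (\<open>pentagon_twisted\<close>) the copies of \<open>F\<close> between two co-associators meet
  their inverses, once copies on disjoint legs are commuted
  and \<open>(\<Delta> \<otimes> 1 \<otimes> 1)(1 \<otimes> \<Delta>) = (1 \<otimes> 1 \<otimes> \<Delta>)(\<Delta> \<otimes> 1)\<close> is used.  The remaining ones are carried past
  \<open>\<Phi> \<otimes> 1\<close> and \<open>1 \<otimes> \<Phi>\<close> by quasi-coassociativity (\<open>left_leg3_intertwines\<close>,
  \<open>right_leg_intertwines\<close>), and what is left is the pentagon for \<open>\<Phi>\<close>.

  For the antipode axioms, consider the functional
  \<open>x \<otimes> y \<otimes> z \<mapsto> S(x) \<alpha> y \<beta> S(z)\<close>.  Replacing \<open>\<alpha>, \<beta>\<close> by \<open>\<alpha>\<^sub>F, \<beta>\<^sub>F\<close> amounts to multiplying the argument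
  by \<open>F\<^sub>1\<^sub>2\<^sup>-\<^sup>1\<close> on the left and by \<open>F\<^sub>2\<^sub>3\<close> on the right (\<open>zigzag_alpha_beta_absorb\<close>), which removes the outer
  factors of \<open>\<Phi>\<^sub>F\<close>.  The factors \<open>(\<Delta> \<otimes> 1)(F)\<close> and \<open>(1 \<otimes> \<Delta>)(F)\<^sup>-\<^sup>1\<close> contribute only their counits, by the
  axioms for \<open>\<alpha>\<close> and \<open>\<beta>\<close>, and these are \<open>1\<close>.  The axiom for \<open>\<Phi>\<^sub>F\<^sup>-\<^sup>1\<close> is treated in the same way.

  For the star structure, the point is that twists compose, \<open>(H\<^sub>F)\<^sub>G = H\<^sub>G\<^sub>F\<close>, on co-associators
  (\<open>coassoc_twisted_twisted\<close>).  As \<open>\<Omega>\<^sub>F F = (F\<^sup>\<dagger>)\<^sup>-\<^sup>1 \<Omega>\<close>, twisting \<open>H\<^sub>F\<close> by \<open>\<Omega>\<^sub>F\<close> is the same as twisting \<open>H\<^sub>\<Omega>\<close> by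
  \<open>(F\<^sup>\<dagger>)\<^sup>-\<^sup>1\<close>.  The conjugation reverses products on every tensor power and carries \<open>\<Delta>\<close> to the coproduct
  of \<open>H\<^sub>\<Omega>\<close>, so \<open>(\<Phi>\<^sub>F\<^sup>\<dagger>)\<^sup>-\<^sup>1\<close> is \<open>(\<Phi>\<^sup>\<dagger>)\<^sup>-\<^sup>1 = \<Phi>\<^sub>\<Omega>\<close> twisted by the same element.  Self-conjugacy is read off from the
  formula for \<open>\<Omega>\<^sub>F\<close>, and \<open>S\<close> and \<open>\<dagger>\<close> do not change under twisting.
\<close>

section \<open>Linear maps, algebra homomorphisms and inverses\<close>

lemma clinearI:
  assumes "\<And>x y. f (x + y) = f x + f y" "\<And>c x. f (c *\<^sub>C x) = c *\<^sub>C f x"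
  shows "clinear f"
  using assms
  by (simp add: Vector_Spaces.linear_iff complex_vector.vector_space_axioms)

lemma clinear_add: "clinear f \<Longrightarrow> f (x + y) = f x + f y"
  and clinear_scaleC: "clinear f \<Longrightarrow> f (c *\<^sub>C x) = c *\<^sub>C f x"
  by (simp_all add: Vector_Spaces.linear_iff)

lemma clinear_id: "clinear id"
  by (rule clinearI) simp_all

lemma clinear_ident: "clinear (\<lambda>x. x)"
  by (rule clinearI) simp_all

lemma algebra_homI:
  assumes "clinear f" "f 1 = 1" "\<And>x y. f (x * y) = f x * f y"
  shows "algebra_hom f"
  using assms by (simp add: algebra_hom_def)

lemma algebra_hom_id: "algebra_hom id"
  by (rule algebra_homI) (simp_all add: clinear_id)

lemma algebra_hom_linear: "algebra_hom f \<Longrightarrow> clinear f"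
  and algebra_hom_one: "algebra_hom f \<Longrightarrow> f 1 = 1"
  and algebra_hom_mult: "algebra_hom f \<Longrightarrow> f (x * y) = f x * f y"
  by (simp_all add: algebra_hom_def)

lemma algebra_hom_comp: "algebra_hom f \<Longrightarrow> algebra_hom g \<Longrightarrow> algebra_hom (\<lambda>x. f (g x))"
  by (rule algebra_homI)
    (auto intro!: clinearI simp: algebra_hom_def clinear_add clinear_scaleC)

lemma inv_elem_right: "invertible_elem x \<Longrightarrow> x * inv_elem x = 1"
  and inv_elem_left: "invertible_elem x \<Longrightarrow> inv_elem x * x = 1"
  unfolding invertible_elem_def using inv_elem_eqI by metis+

lemma invertible_elemI: "x * y = 1 \<Longrightarrow> y * x = 1 \<Longrightarrow> invertible_elem x"
  unfolding invertible_elem_def by blast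

lemma invertible_elem_inv: "invertible_elem x \<Longrightarrow> invertible_elem (inv_elem x)"
  by (rule invertible_elemI [of _ x]) (simp_all add: inv_elem_left inv_elem_right)

lemma inv_elem_inv_elem: "invertible_elem x \<Longrightarrow> inv_elem (inv_elem x) = x"
  by (rule inv_elem_eqI) (simp_all add: inv_elem_left inv_elem_right)

text \<open>
  The form in which inverses cancel inside products that are bracketed to the right.
\<close>

lemma mult_cancel_middle: "x * y = 1 \<Longrightarrow> x * (y * z) = z" for x :: "'a::monoid_mult"
  by (simp add: mult.assoc [symmetric])

lemma inv_elem_mult:
  assumes "invertible_elem x" "invertible_elem y"
  shows "inv_elem (x * y) = inv_elem y * inv_elem x"
  using assms
  by (intro inv_elem_eqI)
    (simp_all add: mult.assoc mult_cancel_middle inv_elem_left inv_elem_right)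

lemma invertible_elem_mult:
  assumes "invertible_elem x" "invertible_elem y"
  shows "invertible_elem (x * y)"
  using assms
  by (intro invertible_elemI [of _ "inv_elem y * inv_elem x"])
    (simp_all add: mult.assoc mult_cancel_middle inv_elem_left inv_elem_right)

lemma algebra_hom_inverse: "algebra_hom f \<Longrightarrow> x * y = 1 \<Longrightarrow> f x * f y = 1"
  by (metis algebra_hom_mult algebra_hom_one)

lemma algebra_hom_invertible: "algebra_hom f \<Longrightarrow> invertible_elem x \<Longrightarrow> invertible_elem (f x)"
  unfolding invertible_elem_def by (metis algebra_hom_inverse)

lemma algebra_hom_inv_elem:
  "algebra_hom f \<Longrightarrow> invertible_elem x \<Longrightarrow> f (inv_elem x) = inv_elem (f x)"
  by (metis algebra_hom_inverse inv_elem_eqI inv_elem_left inv_elem_right)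


section \<open>Maps out of tensor products\<close>

lemma tensor3_induct [case_names tensor add]:
  assumes "\<And>a b c. P (a \<otimes> b \<otimes> c)" "\<And>x y. P x \<Longrightarrow> P y \<Longrightarrow> P (x + y)"
  shows "P t"
proof (induct t)
  case (tensor a s)
  show ?case by (induct s) (simp_all add: assms tensor_add_right)
qed (rule assms)

lemma tensor_lift_linear:
  assumes "balanced g" "\<And>c a b. g (c *\<^sub>C a) b = c *\<^sub>C g a b"
  shows "clinear (tensor_lift g)"
proof (rule clinearI)
  fix x y c
  show "tensor_lift g (x + y) = tensor_lift g x + tensor_lift g y"
    by (rule tensor_lift_add [OF assms(1)])
  show "tensor_lift g (c *\<^sub>C x) = c *\<^sub>C tensor_lift g x"
  proof (induct x)
    case (tensor a b)
    show ?case
      by (simp add: tensor_lift(2) assms tensor_scaleC_left [symmetric])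
  next
    case (add x y)
    then show ?case
      by (simp add: tensor_lift_add assms complex_vector.scale_right_distrib)
  qed
qed

lemma clinear_tensor_map:
  assumes "clinear f" "clinear g"
  shows "clinear (tensor_map f g)"
  unfolding tensor_map_def using assms
  by (intro tensor_lift_linear)
    (auto simp: balanced_def clinear_add clinear_scaleC tensor_add_left tensor_add_right
      tensor_scaleC_left tensor_scaleC_right)

lemma algebra_hom_tensor_map:
  assumes "algebra_hom f" "algebra_hom g"
  shows "algebra_hom (tensor_map f g)"
proof -
  have lin: "clinear f" "clinear g" "clinear (tensor_map f g)"
    using assms by (auto intro: algebra_hom_linear clinear_tensor_map)
  have 1: "tensor_map f g ((a \<otimes> b) * y) = tensor_map f g (a \<otimes> b) * tensor_map f g y" for a b y
    by (induct y) (simp_all add: tensor_times_tensor tensor_map_linear lin assms distrib_left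
        algebra_hom_mult clinear_add)
  show ?thesis
  proof (rule algebra_homI)
    show "tensor_map f g 1 = 1"
      by (simp add: one_tensor_def tensor_map_linear lin assms algebra_hom_one)
    show "tensor_map f g (x * y) = tensor_map f g x * tensor_map f g y" for x y
      by (induct x) (simp_all add: 1 distrib_right clinear_add lin)
  qed (rule lin)
qed

text \<open>
  The rebracketing map is a lift of a lift, and a lift has a meaning only for a balanced map.  The
  outer one is balanced because the inner lift is homogeneous and depends linearly on the third
  factor.
\<close>

lemma tensor_assoc_add: "tensor_assoc (x + y) = tensor_assoc x + tensor_assoc y"
proof -
  define g :: "'c \<Rightarrow> 'a \<Rightarrow> 'b \<Rightarrow> 'a \<otimes> 'b \<otimes> 'c" where "g c = (\<lambda>a b. a \<otimes> b \<otimes> c)" for c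
  have bal: "balanced (g c)" for c
    by (simp add: balanced_def g_def tensor_add_left tensor_add_right tensor_scaleC_left
        tensor_scaleC_right)
  have 1: "tensor_lift (g (c + c')) t = tensor_lift (g c) t + tensor_lift (g c') t" for c c' t
    by (induct t) (simp_all add: tensor_lift_add tensor_lift(2) bal,
        simp add: g_def tensor_add_right)
  have 2: "clinear (tensor_lift (g c))" for c
    by (rule tensor_lift_linear [OF bal]) (simp add: g_def tensor_scaleC_left)
  have 3: "tensor_lift (g (d *\<^sub>C c)) t = d *\<^sub>C tensor_lift (g c) t" for c d t
    by (induct t) (simp_all add: tensor_lift_add tensor_lift(2) bal
        complex_vector.scale_right_distrib, simp add: g_def tensor_scaleC_right)
  have "balanced (\<lambda>ab c. tensor_lift (g c) ab)"
    unfolding balanced_def by (simp add: tensor_lift_add bal 1 3 clinear_scaleC [OF 2])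
  then show ?thesis
    unfolding tensor_assoc_def g_def by (rule tensor_lift_add)
qed

lemma algebra_hom_tensor_assoc:
  "algebra_hom (tensor_assoc ::
     ('a::complex_algebra_1 \<otimes> 'b::complex_algebra_1) \<otimes> 'c::complex_algebra_1 \<Rightarrow> _)"
proof (rule algebra_homI)
  let ?T = "tensor_assoc :: ('a \<otimes> 'b) \<otimes> 'c \<Rightarrow> _"
  have simple: "?T ((c *\<^sub>C s) \<otimes> b) = c *\<^sub>C ?T (s \<otimes> b)" for c s b
    by (induct s) (simp_all add: tensor_scaleC_left [symmetric] tensor_assoc_tensor tensor_add_left
        tensor_assoc_add complex_vector.scale_right_distrib)
  show "clinear ?T"
  proof (rule clinearI)
    show "?T (c *\<^sub>C t) = c *\<^sub>C ?T t" for c t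
      by (induct t) (simp_all add: tensor_scaleC_left [symmetric] simple tensor_assoc_add
          complex_vector.scale_right_distrib)
  qed (rule tensor_assoc_add)
  show "?T 1 = 1"
    by (simp add: one_tensor_def tensor_assoc_tensor)
  have 1: "?T (((a \<otimes> b) \<otimes> c) * (s \<otimes> d)) = ?T ((a \<otimes> b) \<otimes> c) * ?T (s \<otimes> d)" for a b c s d
    by (induct s) (simp_all add: tensor_times_tensor tensor_assoc_tensor distrib_left
        tensor_add_left tensor_assoc_add)
  have 2: "?T (((a \<otimes> b) \<otimes> c) * y) = ?T ((a \<otimes> b) \<otimes> c) * ?T y" for a b c y
    by (induct y) (simp_all add: 1 distrib_left tensor_assoc_add)
  have 3: "?T ((s \<otimes> c) * y) = ?T (s \<otimes> c) * ?T y" for s c y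
    by (induct s) (simp_all add: 2 distrib_right tensor_add_left tensor_assoc_add)
  show "?T (x * y) = ?T x * ?T y" for x y
    by (induct x) (simp_all add: 3 distrib_right tensor_assoc_add)
qed

lemma tensor_map_add:
  "clinear f \<Longrightarrow> clinear g \<Longrightarrow> tensor_map f g (x + y) = tensor_map f g x + tensor_map f g y"
  by (rule clinear_add [OF clinear_tensor_map])

lemma algebra_hom_comult_left:
  fixes \<Delta> :: "'a::complex_algebra_1 \<Rightarrow> 'a \<otimes> 'a"
  assumes "algebra_hom \<Delta>"
  shows "algebra_hom (comult_left \<Delta> :: 'a \<otimes> 'b::complex_algebra_1 \<Rightarrow> _)"
  unfolding comult_left_def [abs_def]
  by (rule algebra_hom_comp [OF algebra_hom_tensor_assoc
        algebra_hom_tensor_map [OF assms algebra_hom_id]])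

lemma comult_left_add: "clinear \<Delta> \<Longrightarrow> comult_left \<Delta> (x + y) = comult_left \<Delta> x + comult_left \<Delta> y"
  by (simp add: comult_left_def tensor_map_add clinear_id tensor_assoc_add)

lemma comult_left_tensor: "clinear \<Delta> \<Longrightarrow> comult_left \<Delta> (a \<otimes> b) = tensor_assoc (\<Delta> a \<otimes> b)"
  by (simp add: comult_left_def tensor_map_linear clinear_id)

lemma
  assumes "algebra_hom (\<epsilon> :: 'a::complex_algebra_1 \<Rightarrow> complex)"
  shows algebra_hom_counit_left:
      "algebra_hom (counit_left \<epsilon> :: 'a \<otimes> 'b::complex_algebra_1 \<Rightarrow> 'b)" (is "algebra_hom ?l")
    and algebra_hom_counit_right:
      "algebra_hom (counit_right \<epsilon> :: 'b \<otimes> 'a \<Rightarrow> 'b)" (is "algebra_hom ?r")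
    and counit_left_tensor: "counit_left \<epsilon> (a \<otimes> (b :: 'b)) = \<epsilon> a *\<^sub>C b"
    and counit_right_tensor: "counit_right \<epsilon> ((b :: 'b) \<otimes> a) = \<epsilon> a *\<^sub>C b"
proof -
  have e: "\<epsilon> (x + y) = \<epsilon> x + \<epsilon> y" "\<epsilon> (c *\<^sub>C x) = c * \<epsilon> x" "\<epsilon> 1 = 1" "\<epsilon> (x * y) = \<epsilon> x * \<epsilon> y" for x y c
    using assms by (simp_all add: algebra_hom_def clinear_add clinear_scaleC scaleC_complex_def)
  have bl: "balanced (\<lambda>a (b :: 'b). \<epsilon> a *\<^sub>C b)" and br: "balanced (\<lambda>(b :: 'b) a. \<epsilon> a *\<^sub>C b)"
    by (simp_all add: balanced_def e complex_vector.scale_left_distrib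
        complex_vector.scale_right_distrib mult.commute)
  show l: "counit_left \<epsilon> (a \<otimes> (b :: 'b)) = \<epsilon> a *\<^sub>C b"
    and r: "counit_right \<epsilon> ((b :: 'b) \<otimes> a) = \<epsilon> a *\<^sub>C b" for a b
    by (simp_all add: counit_left_def counit_right_def tensor_lift(2) bl br)
  have lin: "clinear ?l" "clinear ?r"
    unfolding counit_left_def counit_right_def
    by (rule tensor_lift_linear; simp add: bl br e mult.commute)+
  have l1: "?l ((a \<otimes> b) * y) = ?l (a \<otimes> b) * ?l y" for a b y
    by (induct y) (simp_all add: tensor_times_tensor l e mult_scaleC_left mult_scaleC_right
        distrib_left clinear_add [OF lin(1)] mult.commute)
  have r1: "?r ((b \<otimes> a) * y) = ?r (b \<otimes> a) * ?r y" for a b y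
    by (induct y) (simp_all add: tensor_times_tensor r e mult_scaleC_left mult_scaleC_right
        distrib_left clinear_add [OF lin(2)] mult.commute)
  show "algebra_hom ?l"
  proof (rule algebra_homI)
    show "?l (x * y) = ?l x * ?l y" for x y
      by (induct x) (simp_all add: l1 distrib_right clinear_add [OF lin(1)])
  qed (simp_all add: lin one_tensor_def l e)
  show "algebra_hom ?r"
  proof (rule algebra_homI)
    show "?r (x * y) = ?r x * ?r y" for x y
      by (induct x) (simp_all add: r1 distrib_right clinear_add [OF lin(2)])
  qed (simp_all add: lin one_tensor_def r e)
qed

lemma
  fixes f :: "'a::complex_vector \<Rightarrow> 'b::complex_vector \<Rightarrow> 'c::complex_vector \<Rightarrow> 'd::complex_vector"
  assumes 1: "\<And>b c. clinear (\<lambda>a. f a b c)" and 2: "\<And>a c. clinear (\<lambda>b. f a b c)"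
    and 3: "\<And>a b. clinear (\<lambda>c. f a b c)"
  shows tensor_lift3_tensor: "tensor_lift3 f (a \<otimes> b \<otimes> c) = f a b c"
    and tensor_lift3_add: "tensor_lift3 f (x + y) = tensor_lift3 f x + tensor_lift3 f y"
proof -
  have bal: "balanced (f a)" for a
    using clinear_add [OF 2] clinear_add [OF 3] clinear_scaleC [OF 2] clinear_scaleC [OF 3]
    by (simp add: balanced_def)
  have lin: "clinear (tensor_lift (f a))" for a
    by (rule tensor_lift_linear [OF bal]) (rule clinear_scaleC [OF 2])
  have "tensor_lift (f (a + a')) t = tensor_lift (f a) t + tensor_lift (f a') t" for a a' t
  proof (induct t)
    case (tensor b c)
    show ?case unfolding tensor_lift(2) [OF bal] by (rule clinear_add [OF 1])
  qed (simp_all add: tensor_lift_add bal)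
  moreover have "tensor_lift (f (c *\<^sub>C a)) t = c *\<^sub>C tensor_lift (f a) t" for c a t
  proof (induct t)
    case (tensor b d)
    show ?case unfolding tensor_lift(2) [OF bal] by (rule clinear_scaleC [OF 1])
  qed (simp_all add: tensor_lift_add bal complex_vector.scale_right_distrib)
  ultimately have bal3: "balanced (\<lambda>a. tensor_lift (f a))"
    unfolding balanced_def by (simp add: tensor_lift_add bal clinear_scaleC [OF lin])
  show "tensor_lift3 f (a \<otimes> b \<otimes> c) = f a b c"
    by (simp add: tensor_lift3_def tensor_lift(2) bal bal3)
  show "tensor_lift3 f (x + y) = tensor_lift3 f x + tensor_lift3 f y"
    by (simp add: tensor_lift3_def tensor_lift_add bal3)
qed


section \<open>Embeddings of tensor powers\<close>

text \<open>
  The embeddings \<open>x \<mapsto> x \<otimes> 1\<close> and \<open>x \<mapsto> 1 \<otimes> x\<close> of a tensor power into the next one.  On two-fold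
  tensors they are the leg notations \<open>x\<^sub>1\<^sub>2\<close> and \<open>x\<^sub>2\<^sub>3\<close>; iterating \<open>right_leg\<close> gives \<open>x\<^sub>3\<^sub>4\<close>.
\<close>

definition left_leg ::
  "'a::complex_algebra_1 \<otimes> 'b::complex_algebra_1 \<Rightarrow> 'a \<otimes> 'b \<otimes> 'c::complex_algebra_1" where
  "left_leg x = tensor_assoc (x \<otimes> 1)"

definition right_leg ::
  "'b::complex_algebra_1 \<Rightarrow> 'a::complex_algebra_1 \<otimes> 'b" where
  "right_leg x = 1 \<otimes> x"

definition rebracket4 ::
  "('a::complex_algebra_1 \<otimes> 'b::complex_algebra_1 \<otimes> 'c::complex_algebra_1) \<otimes> 'd::complex_algebra_1
    \<Rightarrow> 'a \<otimes> 'b \<otimes> 'c \<otimes> 'd" where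
  "rebracket4 t = tensor_map id tensor_assoc (tensor_assoc t)"

definition left_leg3 ::
  "'a::complex_algebra_1 \<otimes> 'b::complex_algebra_1 \<otimes> 'c::complex_algebra_1
    \<Rightarrow> 'a \<otimes> 'b \<otimes> 'c \<otimes> 'd::complex_algebra_1" where
  "left_leg3 x = rebracket4 (x \<otimes> 1)"

lemma algebra_hom_tensor_one: "algebra_hom (\<lambda>x. x \<otimes> 1)"
  by (rule algebra_homI)
    (auto intro!: clinearI simp: tensor_add_left tensor_scaleC_left one_tensor_def tensor_times_tensor)

lemma algebra_hom_right_leg: "algebra_hom right_leg"
  by (rule algebra_homI)
    (auto intro!: clinearI simp: right_leg_def tensor_add_right tensor_scaleC_right one_tensor_def
      tensor_times_tensor)

lemma algebra_hom_left_leg: "algebra_hom left_leg"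
  unfolding left_leg_def [abs_def]
  by (rule algebra_hom_comp [OF algebra_hom_tensor_assoc algebra_hom_tensor_one])

lemma algebra_hom_rebracket4: "algebra_hom rebracket4"
  unfolding rebracket4_def [abs_def]
  by (rule algebra_hom_comp [OF algebra_hom_tensor_map [OF algebra_hom_id algebra_hom_tensor_assoc]
        algebra_hom_tensor_assoc])

lemma algebra_hom_left_leg3: "algebra_hom left_leg3"
  unfolding left_leg3_def [abs_def]
  by (rule algebra_hom_comp [OF algebra_hom_rebracket4 algebra_hom_tensor_one])

lemma rebracket4_tensor: "rebracket4 ((a \<otimes> b \<otimes> c) \<otimes> d) = a \<otimes> b \<otimes> c \<otimes> d"
  by (simp add: rebracket4_def tensor_assoc_tensor tensor_map_linear clinear_id
      algebra_hom_linear [OF algebra_hom_tensor_assoc])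

lemmas leg_add =
  clinear_add [OF algebra_hom_linear [OF algebra_hom_right_leg]]
  clinear_add [OF algebra_hom_linear [OF algebra_hom_left_leg]]
  clinear_add [OF algebra_hom_linear [OF algebra_hom_rebracket4]]
  clinear_add [OF algebra_hom_linear [OF algebra_hom_left_leg3]]

lemma left_leg_tensor: "left_leg (a \<otimes> b) = a \<otimes> b \<otimes> 1"
  by (simp add: left_leg_def tensor_assoc_tensor)

lemma left_leg3_tensor: "left_leg3 (a \<otimes> b \<otimes> c) = a \<otimes> b \<otimes> c \<otimes> 1"
  by (simp add: left_leg3_def rebracket4_tensor)

lemma left_leg_right_leg_commute:
  "left_leg x * right_leg (right_leg y) = right_leg (right_leg y) * left_leg x"
  by (induct x)
    (simp_all add: left_leg_tensor right_leg_def tensor_times_tensor leg_add distrib_left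
      distrib_right)

lemma left_leg3_left_leg: "left_leg3 (left_leg x) = left_leg x"
  by (induct x) (simp_all add: left_leg_tensor left_leg3_tensor leg_add one_tensor_def)

lemma left_leg3_right_leg: "left_leg3 (right_leg x) = right_leg (left_leg x)"
  by (induct x) (simp_all add: left_leg_tensor left_leg3_tensor leg_add,
      simp add: right_leg_def left_leg3_tensor)


section \<open>The coproduct on tensor legs\<close>

context
  fixes \<Delta> :: "'a::complex_algebra_1 \<Rightarrow> 'a \<otimes> 'a"
  assumes hom: "algebra_hom \<Delta>"
begin

private lemma lin: "clinear \<Delta>"
  by (rule algebra_hom_linear [OF hom])

private lemma lin_comult_left:
  "clinear (comult_left \<Delta> :: 'a \<otimes> 'b::complex_algebra_1 \<Rightarrow> _)"
  by (rule algebra_hom_linear [OF algebra_hom_comult_left [OF hom]])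

private lemmas lins = clinear_id clinear_ident lin lin_comult_left clinear_tensor_map comult_left_add
  tensor_map_add tensor_map_linear comult_left_tensor tensor_add_left tensor_add_right
  tensor_assoc_add leg_add

lemma comult_left_right_leg: "comult_left \<Delta> (right_leg x) = right_leg (right_leg x)"
  by (simp add: right_leg_def lins algebra_hom_one [OF hom] one_tensor_def tensor_assoc_tensor)

lemma comult_right_left_leg: "tensor_map id (tensor_map id \<Delta>) (left_leg x) = left_leg x"
  by (induct x) (simp_all add: left_leg_tensor lins algebra_hom_one [OF hom])

text \<open>
  Both sides are \<open>(\<Delta> \<otimes> \<Delta>)(t)\<close>.
\<close>

lemma comult_left_comult_right:
  "comult_left \<Delta> (tensor_map id \<Delta> t) = tensor_map id (tensor_map id \<Delta>) (comult_left \<Delta> t)"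
proof (induct t)
  case (tensor a b)
  have "tensor_map id (tensor_map id \<Delta>) (tensor_assoc (s \<otimes> b)) = tensor_assoc (s \<otimes> \<Delta> b)"
      for s :: "'a \<otimes> 'a"
    by (induct s) (simp_all add: lins tensor_assoc_tensor)
  then show ?case by (simp add: lins id_def)
qed (simp_all add: lins)

lemma left_leg3_comult_left: "left_leg3 (comult_left \<Delta> t) = comult_left \<Delta> (left_leg t)"
proof (induct t)
  case (tensor a b)
  have "left_leg3 (tensor_assoc (s \<otimes> b)) = tensor_assoc (s \<otimes> b \<otimes> 1)"
      for s :: "'a \<otimes> 'a"
    by (induct s) (simp_all add: lins tensor_assoc_tensor left_leg3_tensor)
  then show ?case by (simp add: lins left_leg_tensor)
qed (simp_all add: lins)

lemma left_leg3_comult_right: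
    "left_leg3 (tensor_map id \<Delta> t) = tensor_map id (comult_left \<Delta>) (left_leg t)"
proof (induct t)
  case (tensor a b)
  have "left_leg3 (a \<otimes> s) = a \<otimes> tensor_assoc (s \<otimes> 1)"
      for s :: "'a \<otimes> 'a"
    by (induct s) (simp_all add: lins tensor_assoc_tensor left_leg3_tensor)
  then show ?case by (simp add: lins left_leg_tensor)
qed (simp_all add: lins)

lemma right_leg_comult_left:
    "right_leg (comult_left \<Delta> t) = tensor_map id (comult_left \<Delta>) (right_leg t)"
  and right_leg_comult_right:
    "right_leg (tensor_map id \<Delta> t) = tensor_map id (tensor_map id \<Delta>) (right_leg t)"
  by (simp_all add: right_leg_def lins)

text \<open>
  Quasi-coassociativity in the first tensor factor:
  \<open>\<Phi> \<otimes> 1\<close> carries \<open>(1 \<otimes> \<Delta> \<otimes> 1)(\<Delta> \<otimes> 1)\<close> to \<open>(\<Delta> \<otimes> 1 \<otimes> 1)(\<Delta> \<otimes> 1)\<close>.  On \<open>a \<otimes> b\<close> this is the assumption for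
  \<open>a\<close>, tensored with \<open>b\<close> and rebracketed.
\<close>

lemma left_leg3_intertwines:
  fixes t :: "'a \<otimes> 'b::complex_algebra_1"
  assumes "\<And>a. \<Phi> * tensor_map id \<Delta> (\<Delta> a) = comult_left \<Delta> (\<Delta> a) * \<Phi>"
  shows "left_leg3 \<Phi> * tensor_map id (comult_left \<Delta>) (comult_left \<Delta> t) =
    comult_left \<Delta> (comult_left \<Delta> t) * left_leg3 \<Phi>"
proof (induct t)
  case (tensor a b)
  have 1: "rebracket4 ((a \<otimes> s) \<otimes> b) = a \<otimes> tensor_assoc (s \<otimes> b)"
      for a :: 'a and s :: "'a \<otimes> 'a" and b :: 'b
    by (induct s) (simp_all add: lins rebracket4_tensor tensor_assoc_tensor)
  have 2: "rebracket4 (tensor_assoc (s \<otimes> a) \<otimes> b) = tensor_assoc (s \<otimes> a \<otimes> b)"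
      for a :: 'a and s :: "'a \<otimes> 'a" and b :: 'b
    by (induct s) (simp_all add: lins rebracket4_tensor tensor_assoc_tensor)
  have B: "tensor_map id (comult_left \<Delta>) (tensor_assoc (s \<otimes> b)) = rebracket4 (tensor_map id \<Delta> s \<otimes> b)"
      for s :: "'a \<otimes> 'a"
    by (induct s) (simp_all add: lins tensor_assoc_tensor 1)
  have A: "comult_left \<Delta> (tensor_assoc (s \<otimes> b)) = rebracket4 (comult_left \<Delta> s \<otimes> b)"
      for s :: "'a \<otimes> 'a"
    by (induct s) (simp_all add: lins tensor_assoc_tensor 2)
  show ?case
    by (simp add: lins A B [unfolded id_def] left_leg3_def
        algebra_hom_mult [OF algebra_hom_rebracket4, symmetric] tensor_times_tensor
        assms [unfolded id_def] id_def)
qed (simp_all add: lins distrib_left distrib_right)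

lemma right_leg_intertwines:
  assumes "\<And>a. \<Phi> * tensor_map id \<Delta> (\<Delta> a) = comult_left \<Delta> (\<Delta> a) * \<Phi>"
  shows "right_leg \<Phi> * tensor_map id (tensor_map id \<Delta>) (tensor_map id \<Delta> t) =
    tensor_map id (comult_left \<Delta>) (tensor_map id \<Delta> t) * right_leg \<Phi>"
  by (induct t) (simp_all add: lins right_leg_def tensor_times_tensor
      assms [unfolded id_def] id_def distrib_left distrib_right)

end

text \<open>
  A coproduct of the form \<open>F \<Delta>(a) G\<close>, applied to one leg, differs from \<open>\<Delta>\<close> on that leg by outer factors that
  do not depend on the tensor.  With \<open>G = F\<^sup>-\<^sup>1\<close> this is how the twisted coproduct is removed from all
  formulas.
\<close>

lemma comult_left_conjugated:
  assumes "clinear \<Delta>" "clinear (\<lambda>a. F * \<Delta> a * G)"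
  shows "comult_left (\<lambda>a. F * \<Delta> a * G) t = left_leg F * comult_left \<Delta> t * left_leg G"
  by (induct t)
    (simp_all add: assms comult_left_tensor comult_left_add distrib_left distrib_right left_leg_def
      algebra_hom_mult [OF algebra_hom_tensor_assoc, symmetric] tensor_times_tensor)

lemma tensor_map_id_conjugated:
  assumes "clinear f" "clinear (\<lambda>a. p * f a * q)"
  shows "tensor_map id (\<lambda>a. p * f a * q) t = right_leg p * tensor_map id f t * right_leg q"
  by (induct t)
    (simp_all add: assms clinear_id clinear_ident tensor_map_linear tensor_map_add distrib_left
      distrib_right right_leg_def tensor_times_tensor)


section \<open>Twists\<close>

lemma algebra_hom_conjugated:
  assumes "algebra_hom f" "p * q = 1" "q * p = 1"
  shows "algebra_hom (\<lambda>a. p * f a * q)"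
proof (rule algebra_homI)
  show "clinear (\<lambda>a. p * f a * q)"
    using algebra_hom_linear [OF assms(1)]
    by (intro clinearI)
      (simp_all add: clinear_add clinear_scaleC distrib_left distrib_right mult_scaleC_left
        mult_scaleC_right)
qed (simp_all add: assms algebra_hom_one algebra_hom_mult mult.assoc mult_cancel_middle [OF assms(3)])

lemma is_twist_inverse: "is_twist H F \<Longrightarrow> F * inv_elem F = 1" "is_twist H F \<Longrightarrow> inv_elem F * F = 1"
  by (simp_all add: is_twist_def inv_elem_left inv_elem_right)

lemma is_twist_mult:
  assumes "algebra_hom (counit H)" "is_twist H F" "is_twist H G"
  shows "is_twist H (F * G)"
  using assms
  by (simp add: is_twist_def invertible_elem_mult algebra_hom_mult [OF algebra_hom_counit_left]
      algebra_hom_mult [OF algebra_hom_counit_right])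

lemma is_twist_inv:
  assumes "algebra_hom (counit H)" "is_twist H F"
  shows "is_twist H (inv_elem F)"
  using assms
  by (simp add: is_twist_def invertible_elem_inv algebra_hom_inv_elem [OF algebra_hom_counit_left]
      algebra_hom_inv_elem [OF algebra_hom_counit_right] inv_elem_eqI)

lemma is_twist_twisted: "is_twist (twisted H F) G = is_twist H G"
  by (simp add: is_twist_def twisted_def)

lemma twisted_coassoc_eq:
  "coassoc (twisted H F) = left_leg F * comult_left (comult H) F * coassoc H *
    tensor_map id (comult H) (inv_elem F) * right_leg (inv_elem F)"
  by (simp add: twisted_def left_leg_def right_leg_def)

lemma comult_twisted: "comult (twisted H F) = (\<lambda>a. F * comult H a * inv_elem F)"
  by (simp add: twisted_def)

lemma algebra_hom_comult_right:
  "algebra_hom \<Delta> \<Longrightarrow> algebra_hom (tensor_map id \<Delta>)"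
  by (rule algebra_hom_tensor_map [OF algebra_hom_id])

lemma algebra_hom_cancel: "algebra_hom f \<Longrightarrow> x * y = 1 \<Longrightarrow> f x * (f y * z) = z"
  by (rule mult_cancel_middle [OF algebra_hom_inverse])

context
  fixes H :: "'a::complex_algebra_1 quasi_hopf" and F :: "'a \<otimes> 'a"
  assumes comult: "algebra_hom (comult H)" and twist: "is_twist H F"
begin

lemma algebra_hom_comult_twisted: "algebra_hom (comult (twisted H F))"
  unfolding comult_twisted
  by (rule algebra_hom_conjugated [OF comult is_twist_inverse [OF twist]])

lemma comult_left_twisted:
  "comult_left (comult (twisted H F)) t = left_leg F * comult_left (comult H) t * left_leg (inv_elem F)"
  unfolding comult_twisted
  by (rule comult_left_conjugated [OF algebra_hom_linear [OF comult]
        algebra_hom_linear [OF algebra_hom_comult_twisted, unfolded comult_twisted]])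

lemma comult_right_twisted:
  "tensor_map id (comult (twisted H F)) t =
    right_leg F * tensor_map id (comult H) t * right_leg (inv_elem F)"
  unfolding comult_twisted
  by (rule tensor_map_id_conjugated [OF algebra_hom_linear [OF comult]
        algebra_hom_linear [OF algebra_hom_comult_twisted, unfolded comult_twisted]])

lemma comult_right_right_twisted:
  "tensor_map id (tensor_map id (comult (twisted H F))) t =
    right_leg (right_leg F) * tensor_map id (tensor_map id (comult H)) t *
    right_leg (right_leg (inv_elem F))"
proof -
  have eq: "tensor_map id (comult (twisted H F)) =
      (\<lambda>t. right_leg F * tensor_map id (comult H) t * right_leg (inv_elem F))"
    by (rule ext) (rule comult_right_twisted)
  show ?thesis
    unfolding eq
    by (rule tensor_map_id_conjugated)
      (simp_all add: eq [symmetric] algebra_hom_linear algebra_hom_comult_right comult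
        algebra_hom_comult_twisted)
qed

lemma comult_middle_twisted:
  "tensor_map id (comult_left (comult (twisted H F))) (t :: 'a \<otimes> 'a \<otimes> 'b::complex_algebra_1) =
    right_leg (left_leg F) * tensor_map id (comult_left (comult H)) t *
    right_leg (left_leg (inv_elem F))"
proof -
  have eq: "(comult_left (comult (twisted H F)) :: 'a \<otimes> 'b \<Rightarrow> _) =
      (\<lambda>t. left_leg F * comult_left (comult H) t * left_leg (inv_elem F))"
    by (rule ext) (rule comult_left_twisted)
  show ?thesis
    unfolding eq
    by (rule tensor_map_id_conjugated)
      (simp_all add: eq [symmetric] algebra_hom_linear algebra_hom_comult_left comult
        algebra_hom_comult_twisted)
qed

text \<open>
  Twists compose: moving from \<open>\<Delta>\<^sub>F\<close> back to \<open>\<Delta>\<close> in the factor \<open>(\<Delta>\<^sub>F \<otimes> 1)(G) = F\<^sub>1\<^sub>2 (\<Delta> \<otimes> 1)(G) F\<^sub>1\<^sub>2\<^sup>-\<^sup>1\<close> of the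
  left-hand side makes \<open>F\<^sub>1\<^sub>2\<^sup>-\<^sup>1\<close> cancel against the first factor of \<open>\<Phi>\<^sub>F\<close>, and likewise at the other end.
\<close>

lemma coassoc_twisted_twisted:
  assumes G: "is_twist H G"
  shows "coassoc (twisted (twisted H F) G) = coassoc (twisted H (G * F))"
proof -
  note inv = is_twist_inverse [OF twist]
  have FG: "invertible_elem F" "invertible_elem G" using twist G by (simp_all add: is_twist_def)
  show ?thesis
    by (simp add: twisted_coassoc_eq [of "twisted H F"] twisted_coassoc_eq [of H F]
        twisted_coassoc_eq [of H "G * F"] comult_left_twisted comult_right_twisted
        inv_elem_mult FG algebra_hom_mult [OF algebra_hom_left_leg]
        algebra_hom_mult [OF algebra_hom_right_leg]
        algebra_hom_mult [OF algebra_hom_comult_left [OF comult]]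
        algebra_hom_mult [OF algebra_hom_comult_right [OF comult]]
        algebra_hom_cancel [OF algebra_hom_left_leg inv(2)]
        algebra_hom_cancel [OF algebra_hom_right_leg inv(2)] mult.assoc)
qed

end


section \<open>Twisting a quasi-Hopf algebra\<close>

context quasi_hopf_algebra
begin

lemma antipode_simps:
  "antipode H (x + y) = antipode H x + antipode H y"
  "antipode H (c *\<^sub>C x) = c *\<^sub>C antipode H x"
  "antipode H (x * y) = antipode H y * antipode H x"
  "antipode H 1 = 1"
  using antipode_antihom by (simp_all add: algebra_antihom_def clinear_add clinear_scaleC)

lemma comult_linear: "clinear (comult H)"
  by (rule algebra_hom_linear [OF comult_hom])

lemma coassoc_intertwines:
  "coassoc H * tensor_map id (comult H) (comult H a) = comult_left (comult H) (comult H a) * coassoc H"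
  using inv_elem_right [OF coassoc_invertible]
  by (simp add: quasi_coassociative mult.assoc mult_cancel_middle)

lemma invertible_coassoc_twisted:
  assumes "is_twist H F"
  shows "invertible_elem (coassoc (twisted H F))"
    and "inv_elem (coassoc (twisted H F)) =
      right_leg F * tensor_map id (comult H) F * inv_elem (coassoc H) *
      comult_left (comult H) (inv_elem F) * left_leg (inv_elem F)"
proof -
  have F: "invertible_elem F" using assms by (simp add: is_twist_def)
  note homs = algebra_hom_left_leg algebra_hom_right_leg algebra_hom_comult_left [OF comult_hom]
    algebra_hom_comult_right [OF comult_hom]
  note [simp] = homs [THEN algebra_hom_invertible] homs [THEN algebra_hom_inv_elem]
    invertible_elem_mult invertible_elem_inv inv_elem_mult inv_elem_inv_elem F coassoc_invertible
  show "invertible_elem (coassoc (twisted H F))"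
    by (simp add: twisted_coassoc_eq)
  show "inv_elem (coassoc (twisted H F)) =
      right_leg F * tensor_map id (comult H) F * inv_elem (coassoc H) *
      comult_left (comult H) (inv_elem F) * left_leg (inv_elem F)"
    by (simp add: twisted_coassoc_eq mult.assoc)
qed

lemma quasi_coassociative_twisted:
  assumes "is_twist H F"
  shows "tensor_map id (comult (twisted H F)) (comult (twisted H F) a) =
    inv_elem (coassoc (twisted H F)) * comult_left (comult (twisted H F)) (comult (twisted H F) a) *
    coassoc (twisted H F)"
proof -
  note inv = is_twist_inverse [OF assms]
  have swap: "coassoc H * (tensor_map id (comult H) (comult H a) * z) =
      comult_left (comult H) (comult H a) * (coassoc H * z)" for z
    by (simp add: mult.assoc [symmetric] coassoc_intertwines)
  have "coassoc (twisted H F) * tensor_map id (comult (twisted H F)) (comult (twisted H F) a) =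
      comult_left (comult (twisted H F)) (comult (twisted H F) a) * coassoc (twisted H F)"
    unfolding comult_left_twisted [OF comult_hom assms] comult_right_twisted [OF comult_hom assms]
      twisted_coassoc_eq
    unfolding comult_twisted
    by (simp add: mult.assoc algebra_hom_mult [OF algebra_hom_comult_left [OF comult_hom]]
        algebra_hom_mult [OF algebra_hom_comult_right [OF comult_hom]]
        algebra_hom_cancel [OF algebra_hom_left_leg inv(2)]
        algebra_hom_cancel [OF algebra_hom_right_leg inv(2)]
        algebra_hom_cancel [OF algebra_hom_comult_left [OF comult_hom] inv(2)]
        algebra_hom_cancel [OF algebra_hom_comult_right [OF comult_hom] inv(2)] swap)
  then show ?thesis
    using mult_cancel_middle [OF inv_elem_left [OF invertible_coassoc_twisted(1) [OF assms]],
        of "tensor_map id (comult (twisted H F)) (comult (twisted H F) a)"]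
    by (simp add: mult.assoc)
qed

text \<open>
  After expansion, both sides are brought to the form \<open>F\<^sub>1\<^sub>2 (\<Delta> \<otimes> 1 \<otimes> 1)(F\<^sub>1\<^sub>2) \<dots> (1 \<otimes> 1 \<otimes> \<Delta>)(F\<^sub>2\<^sub>3\<^sup>-\<^sup>1) F\<^sub>3\<^sub>4\<^sup>-\<^sup>1\<close> with
  the co-associators in between, where the pentagon of \<open>H\<close> applies.
\<close>

lemma pentagon_twisted:
  assumes "is_twist H F"
  shows "comult_left (comult (twisted H F)) (coassoc (twisted H F)) *
      tensor_map id (tensor_map id (comult (twisted H F))) (coassoc (twisted H F)) =
    left_leg3 (coassoc (twisted H F)) *
      tensor_map id (comult_left (comult (twisted H F))) (coassoc (twisted H F)) *
      right_leg (coassoc (twisted H F))"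
proof -
  let ?\<Delta> = "comult H" and ?G = "inv_elem F"
  \<comment> \<open>\<open>\<Delta>\<close> on the first, second and third leg\<close>
  let ?A = "comult_left ?\<Delta> :: 'a \<otimes> 'a \<otimes> 'a \<Rightarrow> _"
  let ?B = "tensor_map id (comult_left ?\<Delta>) :: 'a \<otimes> 'a \<otimes> 'a \<Rightarrow> _"
  let ?C = "tensor_map id (tensor_map id ?\<Delta>) :: 'a \<otimes> 'a \<otimes> 'a \<Rightarrow> _"
  note inv = is_twist_inverse [OF assms]
  have A: "algebra_hom ?A" and B: "algebra_hom ?B" and C: "algebra_hom ?C"
    by (intro algebra_hom_comult_left algebra_hom_comult_right comult_hom)+
  note homs = A B C algebra_hom_left_leg algebra_hom_right_leg algebra_hom_left_leg3
  note mults = homs [THEN algebra_hom_mult]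
  have pent: "?A (coassoc H) * (?C (coassoc H) * z) =
      left_leg3 (coassoc H) * (?B (coassoc H) * (right_leg (coassoc H) * z))" for z
    using pentagon by (simp add: mult.assoc [symmetric] left_leg3_def rebracket4_def right_leg_def)
  have swap_left: "left_leg3 (coassoc H) * (?B (comult_left ?\<Delta> t) * z) =
      ?A (comult_left ?\<Delta> t) * (left_leg3 (coassoc H) * z)" for t z
    by (simp add: mult.assoc [symmetric] left_leg3_intertwines [OF comult_hom coassoc_intertwines])
  have swap_right: "right_leg (coassoc H) * (?C (tensor_map id ?\<Delta> t) * z) =
      ?B (tensor_map id ?\<Delta> t) * (right_leg (coassoc H) * z)" for t z
    by (simp add: mult.assoc [symmetric] right_leg_intertwines [OF comult_hom coassoc_intertwines])
  have commute: "right_leg (right_leg y) * (left_leg x * z) = left_leg x * (right_leg (right_leg y) * z)"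
    for x y :: "'a \<otimes> 'a" and z
    by (simp add: mult.assoc [symmetric] left_leg_right_leg_commute)
  \<comment> \<open>the pairs \<open>F\<^sup>-\<^sup>1 F\<close> that meet: copies of \<open>F\<close> on adjacent legs, and their images under coproducts\<close>
  note cancels =
    algebra_hom_cancel [OF algebra_hom_left_leg inv(2)]
    algebra_hom_cancel [OF algebra_hom_right_leg inv(2)]
    algebra_hom_cancel [OF algebra_hom_right_leg algebra_hom_inverse [OF algebra_hom_right_leg inv(2)]]
    algebra_hom_cancel [OF algebra_hom_right_leg algebra_hom_inverse [OF algebra_hom_left_leg inv(2)]]
    algebra_hom_cancel [OF C algebra_hom_inverse [OF algebra_hom_comult_left [OF comult_hom] inv(2)]]
    algebra_hom_cancel [OF B algebra_hom_inverse [OF algebra_hom_left_leg inv(2)]]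
    algebra_hom_cancel [OF B algebra_hom_inverse [OF algebra_hom_right_leg inv(2)]]
  show ?thesis
    unfolding comult_left_twisted [OF comult_hom assms] comult_middle_twisted [OF comult_hom assms]
      comult_right_right_twisted [OF comult_hom assms] twisted_coassoc_eq
    by (simp add: mult.assoc mults comult_left_right_leg [OF comult_hom]
        comult_right_left_leg [OF comult_hom] comult_left_comult_right [OF comult_hom]
        left_leg3_left_leg left_leg3_right_leg left_leg3_comult_left [OF comult_hom]
        left_leg3_comult_right [OF comult_hom] right_leg_comult_left [OF comult_hom]
        right_leg_comult_right [OF comult_hom] commute cancels pent swap_left swap_right)
qed

text \<open>
  The map \<open>1 \<otimes> \<epsilon> \<otimes> 1\<close> is multiplicative.  It sends the outer factors of \<open>\<Phi>\<^sub>F\<close> and \<open>\<Phi>\<close> itself to \<open>1\<close>, while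
  \<open>(\<Delta> \<otimes> 1)(F)\<close> and \<open>(1 \<otimes> \<Delta>)(F\<^sup>-\<^sup>1)\<close> become \<open>F\<close> and \<open>F\<^sup>-\<^sup>1\<close> by the counit axioms.
\<close>

lemma counit_coassoc_twisted:
  assumes "is_twist H F"
  shows "tensor_map id (counit_left (counit H)) (coassoc (twisted H F)) = 1"
proof -
  let ?e = "counit_left (counit H) :: 'a \<otimes> 'a \<Rightarrow> 'a"
  have e: "algebra_hom ?e" by (rule algebra_hom_counit_left [OF counit_hom])
  note hom = algebra_hom_comult_right [OF e]
  note lins = clinear_id clinear_ident algebra_hom_linear [OF e] algebra_hom_linear [OF hom] comult_linear
    algebra_hom_linear [OF algebra_hom_comult_left [OF comult_hom]]
    algebra_hom_linear [OF algebra_hom_comult_right [OF comult_hom]]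
  have left: "tensor_map id ?e (left_leg t) = counit_right (counit H) t \<otimes> 1" for t
    by (induct t) (simp_all add: left_leg_tensor tensor_map_linear lins leg_add tensor_map_add
        counit_right_tensor [OF counit_hom] counit_left_tensor [OF counit_hom] tensor_add_left
        clinear_add [OF algebra_hom_linear [OF algebra_hom_counit_right [OF counit_hom]]]
        tensor_scaleC_left tensor_scaleC_right)
  have right: "tensor_map id ?e (right_leg t) = right_leg (?e t)" for t
    by (simp add: right_leg_def tensor_map_linear lins)
  have 1: "tensor_map id ?e (comult_left (comult H) t) = t" for t
  proof (induct t)
    case (tensor a b)
    have "tensor_map id ?e (tensor_assoc (s \<otimes> b)) = counit_right (counit H) s \<otimes> b"
      for s :: "'a \<otimes> 'a"
      by (induct s) (simp_all add: tensor_assoc_tensor tensor_assoc_add tensor_map_linear lins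
          tensor_map_add counit_right_tensor [OF counit_hom] counit_left_tensor [OF counit_hom]
          tensor_add_left clinear_add [OF algebra_hom_linear [OF algebra_hom_counit_right [OF counit_hom]]]
          tensor_scaleC_left tensor_scaleC_right)
    then show ?case by (simp add: comult_left_tensor lins counit_right_comult id_def)
  qed (simp add: comult_left_add tensor_map_add lins)
  have 2: "tensor_map id ?e (tensor_map id (comult H) t) = t" for t
    by (induct t) (simp_all add: tensor_map_linear tensor_map_add lins counit_left_comult)
  show ?thesis
    using assms is_twist_inv [OF counit_hom assms] is_twist_inverse [OF assms]
    by (simp add: twisted_coassoc_eq algebra_hom_mult [OF hom] left right 1 2 counit_coassoc
        is_twist_def one_tensor_def [symmetric] algebra_hom_one [OF algebra_hom_right_leg])
qed

text \<open>
  These two maps put the twisted elements and the two antipode axioms in one form: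
  \<open>\<alpha>\<^sub>F\<close> and \<open>\<beta>\<^sub>F\<close> are their values at \<open>F\<^sup>-\<^sup>1\<close> and \<open>F\<close>, and the axioms give their values on coproducts.
\<close>

definition alpha_contract :: "'a \<otimes> 'a \<Rightarrow> 'a" where
  "alpha_contract = tensor_lift (\<lambda>x y. antipode H x * alpha H * y)"

definition beta_contract :: "'a \<otimes> 'a \<Rightarrow> 'a" where
  "beta_contract = tensor_lift (\<lambda>x y. x * beta H * antipode H y)"

lemmas bilinear_simps = antipode_simps distrib_left distrib_right mult_scaleC_left mult_scaleC_right

lemma
  shows alpha_contract_tensor: "alpha_contract (x \<otimes> y) = antipode H x * alpha H * y"
    and alpha_contract_add: "alpha_contract (s + t) = alpha_contract s + alpha_contract t"
    and beta_contract_tensor: "beta_contract (x \<otimes> y) = x * beta H * antipode H y"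
    and beta_contract_add: "beta_contract (s + t) = beta_contract s + beta_contract t"
proof -
  have *: "balanced (\<lambda>x y. antipode H x * alpha H * y)" "balanced (\<lambda>x y. x * beta H * antipode H y)"
    by (simp_all add: balanced_def bilinear_simps mult.assoc)
  show "alpha_contract (x \<otimes> y) = antipode H x * alpha H * y"
    "alpha_contract (s + t) = alpha_contract s + alpha_contract t"
    "beta_contract (x \<otimes> y) = x * beta H * antipode H y"
    "beta_contract (s + t) = beta_contract s + beta_contract t"
    unfolding alpha_contract_def beta_contract_def
    by (simp_all add: tensor_lift(2) tensor_lift_add *)
qed

lemma alpha_twisted: "alpha (twisted H F) = alpha_contract (inv_elem F)"
proof -
  have lin: "clinear (antipode H)"
    using antipode_antihom by (simp add: algebra_antihom_def)
  have bal: "balanced ((*) :: 'a \<Rightarrow> 'a \<Rightarrow> 'a)"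
    by (simp add: balanced_def bilinear_simps)
  have "tensor_lift (*) ((1 \<otimes> alpha H) * tensor_map (antipode H) id t) = alpha_contract t" for t
    by (induct t) (simp_all add: tensor_map_linear tensor_map_add lin clinear_id clinear_ident
        tensor_times_tensor
        tensor_lift(2) bal tensor_lift_add alpha_contract_tensor alpha_contract_add distrib_left
        mult.assoc)
  then show ?thesis by (simp add: twisted_def)
qed

lemma beta_twisted: "beta (twisted H F) = beta_contract F"
proof -
  have lin: "clinear (antipode H)"
    using antipode_antihom by (simp add: algebra_antihom_def)
  have bal: "balanced ((*) :: 'a \<Rightarrow> 'a \<Rightarrow> 'a)"
    by (simp add: balanced_def bilinear_simps)
  have "tensor_lift (*) ((1 \<otimes> beta H) * tensor_map id (antipode H) t) = beta_contract t" for t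
    by (induct t) (simp_all add: tensor_map_linear tensor_map_add lin clinear_id clinear_ident
        tensor_times_tensor
        tensor_lift(2) bal tensor_lift_add beta_contract_tensor beta_contract_add distrib_left
        mult.assoc)
  then show ?thesis by (simp add: twisted_def)
qed

lemma antipode_twisted: "antipode (twisted H F) = antipode H"
  and counit_twisted: "counit (twisted H F) = counit H"
  by (simp_all add: twisted_def)

text \<open>
  Contracting \<open>x \<otimes> y\<close> with \<open>\<alpha>\<^sub>F\<close> in the middle is contracting \<open>F\<^sup>-\<^sup>1 (x \<otimes> y)\<close> with \<open>\<alpha>\<close>, because \<open>S\<close> reverses
  products.  On \<open>F \<Delta>(a) F\<^sup>-\<^sup>1\<close> the first factor disappears, and \<open>\<Delta>(a)\<close>, now leftmost, comes out as \<open>\<epsilon>(a)\<close>.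
\<close>

lemma antipode_alpha_twisted:
  assumes "is_twist H F"
  shows "tensor_lift (\<lambda>x y. antipode (twisted H F) x * alpha (twisted H F) * y)
      (comult (twisted H F) a) = counit (twisted H F) a *\<^sub>C alpha (twisted H F)"
proof -
  have bal: "balanced (\<lambda>x y. antipode H x * c * y)" for c
    by (simp add: balanced_def bilinear_simps mult.assoc)
  have absorb_simple: "antipode H x * alpha_contract u * y = alpha_contract (u * (x \<otimes> y))" for u x y
    by (induct u) (simp_all add: alpha_contract_tensor alpha_contract_add tensor_times_tensor
        bilinear_simps mult.assoc)
  have absorb: "tensor_lift (\<lambda>x y. antipode H x * alpha_contract u * y) t = alpha_contract (u * t)" for u t
  proof (induct t)
    case (tensor x y)
    show ?case unfolding tensor_lift(2) [OF bal] by (rule absorb_simple)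
  qed (simp_all add: tensor_lift_add bal alpha_contract_add distrib_left)
  have "alpha_contract (s * (x \<otimes> y)) = antipode H x * alpha_contract s * y" for s x y
    by (simp add: absorb_simple)
  moreover have "alpha_contract (comult H a) = counit H a *\<^sub>C alpha H"
    unfolding alpha_contract_def by (rule antipode_alpha)
  ultimately have "alpha_contract (comult H a * t) = counit H a *\<^sub>C alpha_contract t" for t
    by (induct t) (simp_all add: alpha_contract_tensor alpha_contract_add distrib_left
        mult_scaleC_left mult_scaleC_right complex_vector.scale_right_distrib)
  then show ?thesis
    by (simp add: alpha_twisted antipode_twisted counit_twisted comult_twisted
        absorb [unfolded mult.assoc] mult.assoc
        mult_cancel_middle [OF is_twist_inverse(2) [OF assms]])
qed

text \<open>
  The mirror image: \<open>\<beta>\<^sub>F\<close> in the middle multiplies the argument by \<open>F\<close> on the right.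
\<close>

lemma antipode_beta_twisted:
  assumes "is_twist H F"
  shows "tensor_lift (\<lambda>x y. x * beta (twisted H F) * antipode (twisted H F) y)
      (comult (twisted H F) a) = counit (twisted H F) a *\<^sub>C beta (twisted H F)"
proof -
  have bal: "balanced (\<lambda>x y. x * c * antipode H y)" for c
    by (simp add: balanced_def bilinear_simps mult.assoc)
  have absorb_simple: "x * beta_contract u * antipode H y = beta_contract ((x \<otimes> y) * u)" for u x y
    by (induct u) (simp_all add: beta_contract_tensor beta_contract_add tensor_times_tensor
        bilinear_simps mult.assoc)
  have absorb: "tensor_lift (\<lambda>x y. x * beta_contract u * antipode H y) t = beta_contract (t * u)" for u t
  proof (induct t)
    case (tensor x y)
    show ?case unfolding tensor_lift(2) [OF bal] by (rule absorb_simple)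
  qed (simp_all add: tensor_lift_add bal beta_contract_add distrib_right)
  have "beta_contract ((x \<otimes> y) * s) = x * beta_contract s * antipode H y" for s x y
    by (simp add: absorb_simple)
  moreover have "beta_contract (comult H a) = counit H a *\<^sub>C beta H"
    unfolding beta_contract_def by (rule antipode_beta)
  ultimately have "beta_contract (t * comult H a) = counit H a *\<^sub>C beta_contract t" for t
    by (induct t) (simp_all add: beta_contract_tensor beta_contract_add distrib_right
        mult_scaleC_left mult_scaleC_right complex_vector.scale_right_distrib)
  then show ?thesis
    by (simp add: beta_twisted antipode_twisted counit_twisted comult_twisted
        absorb [unfolded mult.assoc] mult.assoc
        is_twist_inverse(2) [OF assms])
qed

text \<open>
  The functionals of the two axioms that relate antipode and co-associator; the elements
  in the places of \<open>\<alpha>\<close> and \<open>\<beta>\<close> are variable, so that they cover \<open>H\<close> and its twists.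
\<close>

definition zigzag_alpha_beta :: "'a \<Rightarrow> 'a \<Rightarrow> 'a \<otimes> 'a \<otimes> 'a \<Rightarrow> 'a" where
  "zigzag_alpha_beta p q = tensor_lift3 (\<lambda>x y z. antipode H x * p * y * q * antipode H z)"

definition zigzag_beta_alpha :: "'a \<Rightarrow> 'a \<Rightarrow> 'a \<otimes> 'a \<otimes> 'a \<Rightarrow> 'a" where
  "zigzag_beta_alpha p q = tensor_lift3 (\<lambda>x y z. x * q * antipode H y * p * z)"

lemma
  shows zigzag_alpha_beta_tensor:
      "zigzag_alpha_beta p q (x \<otimes> y \<otimes> z) = antipode H x * p * y * q * antipode H z"
    and zigzag_alpha_beta_add:
      "zigzag_alpha_beta p q (s + t) = zigzag_alpha_beta p q s + zigzag_alpha_beta p q t"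
  unfolding zigzag_alpha_beta_def
  by (rule tensor_lift3_tensor tensor_lift3_add; rule clinearI; simp add: bilinear_simps)+

lemma
  shows zigzag_beta_alpha_tensor:
      "zigzag_beta_alpha p q (x \<otimes> y \<otimes> z) = x * q * antipode H y * p * z"
    and zigzag_beta_alpha_add:
      "zigzag_beta_alpha p q (s + t) = zigzag_beta_alpha p q s + zigzag_beta_alpha p q t"
  unfolding zigzag_beta_alpha_def
  by (rule tensor_lift3_tensor tensor_lift3_add; rule clinearI; simp add: bilinear_simps)+

text \<open>
  With \<open>u = \<Sum> u\<^sub>1 \<otimes> u\<^sub>2\<close> and \<open>v = \<Sum> v\<^sub>1 \<otimes> v\<^sub>2\<close>, the left-hand side at \<open>x \<otimes> y \<otimes> z\<close> is
  \<open>\<Sum> S(u\<^sub>1 x) \<alpha> (u\<^sub>2 y v\<^sub>1) \<beta> S(z v\<^sub>2)\<close>.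
\<close>

lemma zigzag_alpha_beta_absorb:
  "zigzag_alpha_beta (alpha_contract u) (beta_contract v) t =
    zigzag_alpha_beta (alpha H) (beta H) (left_leg u * t * right_leg v)"
proof (induct t rule: tensor3_induct)
  case (tensor x y z)
  have 1: "antipode H x * alpha_contract u * y * c * beta H * antipode H d * antipode H z =
      zigzag_alpha_beta (alpha H) (beta H) (left_leg u * (x \<otimes> y \<otimes> z) * right_leg (c \<otimes> d))" for c d
    by (induct u) (simp_all add: alpha_contract_tensor alpha_contract_add zigzag_alpha_beta_tensor
        zigzag_alpha_beta_add left_leg_tensor right_leg_def tensor_times_tensor leg_add bilinear_simps
        mult.assoc)
  show ?case
    by (induct v) (simp_all add: zigzag_alpha_beta_tensor zigzag_alpha_beta_add beta_contract_tensor
        beta_contract_add leg_add distrib_left distrib_right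
        1 [symmetric, unfolded mult.assoc] mult.assoc)
qed (simp add: zigzag_alpha_beta_add distrib_left distrib_right)

lemma zigzag_beta_alpha_absorb:
  "zigzag_beta_alpha (alpha_contract u) (beta_contract v) t =
    zigzag_beta_alpha (alpha H) (beta H) (right_leg u * t * left_leg v)"
proof (induct t rule: tensor3_induct)
  case (tensor x y z)
  have 1: "x * c * beta H * antipode H d * antipode H y * alpha_contract u * z =
      zigzag_beta_alpha (alpha H) (beta H) (right_leg u * (x \<otimes> y \<otimes> z) * left_leg (c \<otimes> d))" for c d
    by (induct u) (simp_all add: alpha_contract_tensor alpha_contract_add zigzag_beta_alpha_tensor
        zigzag_beta_alpha_add left_leg_tensor right_leg_def tensor_times_tensor leg_add bilinear_simps
        mult.assoc tensor_add_right)
  show ?case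
    by (induct v) (simp_all add: zigzag_beta_alpha_tensor zigzag_beta_alpha_add beta_contract_tensor
        beta_contract_add leg_add distrib_left distrib_right
        1 [symmetric, unfolded mult.assoc] mult.assoc)
qed (simp add: zigzag_beta_alpha_add distrib_left distrib_right)

lemma counit_left_add:
    "counit_left (counit H) (s + t) =
      counit_left (counit H) s + counit_left (counit H) (t :: 'a \<otimes> 'a)"
  and counit_right_add:
    "counit_right (counit H) (s + t) =
      counit_right (counit H) s + counit_right (counit H) (t :: 'a \<otimes> 'a)"
  by (rule clinear_add [OF algebra_hom_linear] algebra_hom_counit_left algebra_hom_counit_right
      counit_hom)+

text \<open>
  In \<open>S(x) S(a\<^sub>1) \<alpha> a\<^sub>2 y \<beta> S(z) S(b)\<close> the inner part collapses to \<open>\<epsilon>(a) \<alpha>\<close>; the three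
  lemmas after this one rest on the same collapse, at the other end or with \<open>\<beta>\<close>.
\<close>

lemma zigzag_alpha_beta_comult_left:
  "zigzag_alpha_beta (alpha H) (beta H) (comult_left (comult H) u * t) =
    zigzag_alpha_beta (alpha H) (beta H) t * antipode H (counit_left (counit H) u)"
proof (induct t rule: tensor3_induct)
  case (tensor x y z)
  show ?case
  proof (induct u)
    case (tensor a b)
    have "zigzag_alpha_beta (alpha H) (beta H) (tensor_assoc (s \<otimes> b) * (x \<otimes> y \<otimes> z)) =
        antipode H x * alpha_contract s * y * beta H * antipode H z * antipode H b" for s
      by (induct s) (simp_all add: tensor_assoc_tensor tensor_assoc_add tensor_add_left
          tensor_times_tensor zigzag_alpha_beta_tensor zigzag_alpha_beta_add alpha_contract_tensor
          alpha_contract_add bilinear_simps mult.assoc)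
    moreover have "alpha_contract (comult H a) = counit H a *\<^sub>C alpha H"
      unfolding alpha_contract_def by (rule antipode_alpha)
    ultimately show ?case
      by (simp add: comult_left_tensor comult_linear zigzag_alpha_beta_tensor
          counit_left_tensor [OF counit_hom] bilinear_simps mult.assoc)
  qed (simp_all add: comult_left_add comult_linear zigzag_alpha_beta_add counit_left_add bilinear_simps)
qed (simp add: zigzag_alpha_beta_add bilinear_simps)

lemma zigzag_alpha_beta_comult_right:
  "zigzag_alpha_beta (alpha H) (beta H) (t * tensor_map id (comult H) u) =
    antipode H (counit_right (counit H) u) * zigzag_alpha_beta (alpha H) (beta H) t"
proof (induct t rule: tensor3_induct)
  case (tensor x y z)
  show ?case
  proof (induct u)
    case (tensor a b)
    have "zigzag_alpha_beta (alpha H) (beta H) ((x \<otimes> y \<otimes> z) * (a \<otimes> s)) =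
        antipode H a * antipode H x * alpha H * y * beta_contract s * antipode H z" for s
      by (induct s) (simp_all add: tensor_add_right
          tensor_times_tensor zigzag_alpha_beta_tensor zigzag_alpha_beta_add beta_contract_tensor
          beta_contract_add bilinear_simps mult.assoc)
    moreover have "beta_contract (comult H b) = counit H b *\<^sub>C beta H"
      unfolding beta_contract_def by (rule antipode_beta)
    ultimately show ?case
      by (simp add: tensor_map_linear clinear_id clinear_ident comult_linear zigzag_alpha_beta_tensor
          counit_right_tensor [OF counit_hom] bilinear_simps mult.assoc)
  qed (simp_all add: tensor_map_add clinear_id clinear_ident comult_linear zigzag_alpha_beta_add
      counit_right_add bilinear_simps)
qed (simp add: zigzag_alpha_beta_add bilinear_simps)

lemma zigzag_beta_alpha_comult_right:
  "zigzag_beta_alpha (alpha H) (beta H) (tensor_map id (comult H) u * t) =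
    counit_right (counit H) u * zigzag_beta_alpha (alpha H) (beta H) t"
proof (induct t rule: tensor3_induct)
  case (tensor x y z)
  show ?case
  proof (induct u)
    case (tensor a b)
    have "zigzag_beta_alpha (alpha H) (beta H) ((a \<otimes> s) * (x \<otimes> y \<otimes> z)) =
        a * x * beta H * antipode H y * alpha_contract s * z" for s
      by (induct s) (simp_all add: tensor_add_right
          tensor_times_tensor zigzag_beta_alpha_tensor zigzag_beta_alpha_add alpha_contract_tensor
          alpha_contract_add bilinear_simps mult.assoc)
    moreover have "alpha_contract (comult H b) = counit H b *\<^sub>C alpha H"
      unfolding alpha_contract_def by (rule antipode_alpha)
    ultimately show ?case
      by (simp add: tensor_map_linear clinear_id clinear_ident comult_linear zigzag_beta_alpha_tensor
          counit_right_tensor [OF counit_hom] bilinear_simps mult.assoc)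
  qed (simp_all add: tensor_map_add clinear_id clinear_ident comult_linear zigzag_beta_alpha_add
      counit_right_add bilinear_simps)
qed (simp add: zigzag_beta_alpha_add bilinear_simps)

lemma zigzag_beta_alpha_comult_left:
  "zigzag_beta_alpha (alpha H) (beta H) (t * comult_left (comult H) u) =
    zigzag_beta_alpha (alpha H) (beta H) t * counit_left (counit H) u"
proof (induct t rule: tensor3_induct)
  case (tensor x y z)
  show ?case
  proof (induct u)
    case (tensor a b)
    have "zigzag_beta_alpha (alpha H) (beta H) ((x \<otimes> y \<otimes> z) * tensor_assoc (s \<otimes> b)) =
        x * beta_contract s * antipode H y * alpha H * z * b" for s
      by (induct s) (simp_all add: tensor_assoc_tensor tensor_assoc_add tensor_add_left
          tensor_times_tensor zigzag_beta_alpha_tensor zigzag_beta_alpha_add beta_contract_tensor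
          beta_contract_add bilinear_simps mult.assoc)
    moreover have "beta_contract (comult H a) = counit H a *\<^sub>C beta H"
      unfolding beta_contract_def by (rule antipode_beta)
    ultimately show ?case
      by (simp add: comult_left_tensor comult_linear zigzag_beta_alpha_tensor
          counit_left_tensor [OF counit_hom] bilinear_simps mult.assoc)
  qed (simp_all add: comult_left_add comult_linear zigzag_beta_alpha_add counit_left_add bilinear_simps)
qed (simp add: zigzag_beta_alpha_add bilinear_simps)

lemma zigzag_alpha_beta_twisted:
  assumes "is_twist H F"
  shows "zigzag_alpha_beta (alpha (twisted H F)) (beta (twisted H F)) (coassoc (twisted H F)) = 1"
proof -
  note inv = is_twist_inverse [OF assms]
  have "left_leg (inv_elem F) * coassoc (twisted H F) * right_leg F =
      comult_left (comult H) F * coassoc H * tensor_map id (comult H) (inv_elem F)"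
    by (simp add: twisted_coassoc_eq mult.assoc algebra_hom_cancel [OF algebra_hom_left_leg inv(2)]
        algebra_hom_inverse [OF algebra_hom_right_leg inv(2)])
  then show ?thesis
    using assms is_twist_inv [OF counit_hom assms]
    by (simp add: alpha_twisted beta_twisted zigzag_alpha_beta_absorb
        zigzag_alpha_beta_comult_left zigzag_alpha_beta_comult_right mult.assoc is_twist_def
        antipode_simps antipode_coassoc [folded zigzag_alpha_beta_def])
qed

lemma zigzag_beta_alpha_twisted:
  assumes "is_twist H F"
  shows "zigzag_beta_alpha (alpha (twisted H F)) (beta (twisted H F))
    (inv_elem (coassoc (twisted H F))) = 1"
proof -
  note inv = is_twist_inverse [OF assms]
  have "right_leg (inv_elem F) * inv_elem (coassoc (twisted H F)) * left_leg F =
      tensor_map id (comult H) F * inv_elem (coassoc H) * comult_left (comult H) (inv_elem F)"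
    by (simp add: invertible_coassoc_twisted [OF assms] mult.assoc
        algebra_hom_cancel [OF algebra_hom_right_leg inv(2)]
        algebra_hom_inverse [OF algebra_hom_left_leg inv(2)])
  then show ?thesis
    using assms is_twist_inv [OF counit_hom assms]
    by (simp add: alpha_twisted beta_twisted zigzag_beta_alpha_absorb
        zigzag_beta_alpha_comult_left zigzag_beta_alpha_comult_right mult.assoc is_twist_def
        antipode_simps antipode_coassoc_inv [folded zigzag_beta_alpha_def])
qed

theorem quasi_hopf_algebra_twisted:
  assumes "is_twist H F"
  shows "quasi_hopf_algebra (twisted H F)"
proof
  note hom = algebra_hom_comult_twisted [OF comult_hom assms]
  show "algebra_hom (counit (twisted H F))" "algebra_antihom (antipode (twisted H F))"
    "bij (antipode (twisted H F))"
    by (simp_all add: twisted_def counit_hom antipode_antihom antipode_bij)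
  show "algebra_hom (comult (twisted H F))" by (rule hom)
  show "invertible_elem (coassoc (twisted H F))" by (rule invertible_coassoc_twisted [OF assms])
  have "counit_left (counit H) (inv_elem F) = 1" "counit_right (counit H) (inv_elem F) = 1"
    "counit_left (counit H) F = 1" "counit_right (counit H) F = 1"
    using assms is_twist_inv [OF counit_hom assms] by (simp_all add: is_twist_def)
  then show "counit_left (counit (twisted H F)) (comult (twisted H F) a) = a"
    "counit_right (counit (twisted H F)) (comult (twisted H F) a) = a" for a
    by (simp_all add: counit_twisted comult_twisted counit_left_comult counit_right_comult
        algebra_hom_mult [OF algebra_hom_counit_left [OF counit_hom]]
        algebra_hom_mult [OF algebra_hom_counit_right [OF counit_hom]])
  show "tensor_map id (counit_left (counit (twisted H F))) (coassoc (twisted H F)) = 1"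
    unfolding counit_twisted by (rule counit_coassoc_twisted [OF assms])
  show "tensor_lift3 (\<lambda>x y z. antipode (twisted H F) x * alpha (twisted H F) * y *
      beta (twisted H F) * antipode (twisted H F) z) (coassoc (twisted H F)) = 1"
    using zigzag_alpha_beta_twisted [OF assms]
    by (simp add: zigzag_alpha_beta_def antipode_twisted)
  show "tensor_lift3 (\<lambda>x y z. x * beta (twisted H F) * antipode (twisted H F) y *
      alpha (twisted H F) * z) (inv_elem (coassoc (twisted H F))) = 1"
    using zigzag_beta_alpha_twisted [OF assms]
    by (simp add: zigzag_beta_alpha_def antipode_twisted)
qed (use quasi_coassociative_twisted [OF assms] pentagon_twisted [OF assms]
    antipode_alpha_twisted [OF assms] antipode_beta_twisted [OF assms] in
  \<open>simp_all add: left_leg3_def rebracket4_def right_leg_def\<close>)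

end


section \<open>Conjugations on tensor powers\<close>

text \<open>
  On tensor powers the conjugation acts factor by factor and again reverses products.
\<close>

definition antilinear_antihom :: "('a::complex_algebra_1 \<Rightarrow> 'b::complex_algebra_1) \<Rightarrow> bool" where
  "antilinear_antihom f \<longleftrightarrow> antilinear f \<and> f 1 = 1 \<and> (\<forall>x y. f (x * y) = f y * f x)"

lemma antilinear_antihom_simps:
  assumes "antilinear_antihom f"
  shows "f (x + y) = f x + f y" "f (c *\<^sub>C x) = cnj c *\<^sub>C f x" "f 1 = 1" "f (x * y) = f y * f x"
  using assms by (simp_all add: antilinear_antihom_def antilinear_def)

lemma antilinear_antihom_invertible:
  "antilinear_antihom f \<Longrightarrow> invertible_elem x \<Longrightarrow> invertible_elem (f x)"
  unfolding invertible_elem_def by (metis antilinear_antihom_simps(3,4))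

lemma antilinear_antihom_inv_elem:
  assumes "antilinear_antihom f" "invertible_elem x"
  shows "f (inv_elem x) = inv_elem (f x)"
  using assms
  by (intro inv_elem_eqI [symmetric])
    (simp_all add: antilinear_antihom_simps(4) [OF assms(1), symmetric]
      antilinear_antihom_simps(3) [OF assms(1)] inv_elem_left inv_elem_right)

lemma conjugation_antilinear_antihom:
  assumes "conjugation dag"
  shows "antilinear_antihom dag"
proof -
  have "dag (dag 1 * 1) = dag 1 * dag (dag 1)" and "dag (dag x) = x" for x
    using assms unfolding conjugation_def by blast+
  then have "dag 1 = 1" by simp
  then show ?thesis using assms by (simp add: conjugation_def antilinear_antihom_def)
qed

lemma antilinear_antihom_tensor_map:
  assumes "antilinear_antihom f" "antilinear_antihom g"
  shows "antilinear_antihom (tensor_map f g)"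
proof -
  have anti: "antilinear f" "antilinear g"
    using assms by (simp_all add: antilinear_antihom_def)
  note simps = antilinear_antihom_simps [OF assms(1)] antilinear_antihom_simps [OF assms(2)]
  have bal: "balanced (\<lambda>a b. f a \<otimes> g b)"
    by (simp add: balanced_def simps tensor_add_left tensor_add_right tensor_scaleC_left
        tensor_scaleC_right)
  have add: "tensor_map f g (x + y) = tensor_map f g x + tensor_map f g y" for x y
    unfolding tensor_map_def by (rule tensor_lift_add [OF bal])
  have scale: "tensor_map f g (c *\<^sub>C x) = cnj c *\<^sub>C tensor_map f g x" for c x
    by (induct x) (simp_all add: add complex_vector.scale_right_distrib
        tensor_scaleC_left [symmetric] tensor_map_antilinear anti simps)
  have 1: "tensor_map f g ((a \<otimes> b) * y) = tensor_map f g y * tensor_map f g (a \<otimes> b)" for a b y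
    by (induct y) (simp_all add: add distrib_left distrib_right tensor_times_tensor
        tensor_map_antilinear anti simps)
  have "tensor_map f g (x * y) = tensor_map f g y * tensor_map f g x" for x y
    by (induct x) (simp_all add: add distrib_left distrib_right 1)
  then show ?thesis
    by (simp add: antilinear_antihom_def antilinear_def add scale one_tensor_def
        tensor_map_antilinear anti simps)
qed

context
  fixes dag :: "'a::complex_algebra_1 \<Rightarrow> 'a"
  assumes dag: "antilinear_antihom dag"
begin

lemma antilinear_antihom_conj2: "antilinear_antihom (conj2 dag)"
  unfolding conj2_def by (rule antilinear_antihom_tensor_map [OF dag dag])

lemma antilinear_antihom_conj3: "antilinear_antihom (conj3 dag)"
  unfolding conj3_def
  by (intro antilinear_antihom_tensor_map dag)

lemma conj2_tensor: "conj2 dag (a \<otimes> b) = dag a \<otimes> dag b"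
  using dag unfolding conj2_def antilinear_antihom_def by (simp add: tensor_map_antilinear)

lemma conj3_tensor: "conj3 dag (a \<otimes> t) = dag a \<otimes> conj2 dag t"
  using dag antilinear_antihom_conj2 unfolding conj3_def conj2_def antilinear_antihom_def
  by (simp add: tensor_map_antilinear)

lemmas conj_add = antilinear_antihom_simps(1) [OF antilinear_antihom_conj2]
  antilinear_antihom_simps(1) [OF antilinear_antihom_conj3]

lemma conj3_left_leg: "conj3 dag (left_leg t) = left_leg (conj2 dag t)"
  by (induct t) (simp_all add: left_leg_tensor conj2_tensor conj3_tensor conj_add leg_add
      antilinear_antihom_simps(3) [OF dag])

lemma conj3_right_leg: "conj3 dag (right_leg t) = right_leg (conj2 dag t)"
  by (simp add: right_leg_def conj3_tensor antilinear_antihom_simps(3) [OF dag])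

text \<open>
  The conjugation takes \<open>\<Delta>\<close> on one leg to \<open>\<Delta>'\<close> on that leg as soon as it takes \<open>\<Delta>\<close> to \<open>\<Delta>'\<close>.  In a
  quasi-Hopf star-algebra \<open>\<Delta>'\<close> is the coproduct twisted by \<open>\<Omega>\<close>.
\<close>

lemma conj3_comult_left:
  assumes "clinear \<Delta>" "clinear \<Delta>'" "\<And>a. conj2 dag (\<Delta> a) = \<Delta>' (dag a)"
  shows "conj3 dag (comult_left \<Delta> t) = comult_left \<Delta>' (conj2 dag t)"
proof (induct t)
  case (tensor a b)
  have "conj3 dag (tensor_assoc (s \<otimes> b)) = tensor_assoc (conj2 dag s \<otimes> dag b)" for s
    by (induct s) (simp_all add: tensor_assoc_tensor tensor_assoc_add tensor_add_left conj2_tensor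
        conj3_tensor conj_add)
  then show ?case by (simp add: comult_left_tensor assms conj2_tensor)
qed (simp_all add: comult_left_add assms conj_add)

lemma conj3_comult_right:
  assumes "clinear \<Delta>" "clinear \<Delta>'" "\<And>a. conj2 dag (\<Delta> a) = \<Delta>' (dag a)"
  shows "conj3 dag (tensor_map id \<Delta> t) = tensor_map id \<Delta>' (conj2 dag t)"
  by (induct t) (simp_all add: tensor_map_linear tensor_map_add clinear_id clinear_ident assms
      conj2_tensor conj3_tensor conj_add)

end

lemma conj2_involution:
  assumes "conjugation dag"
  shows "conj2 dag (conj2 dag t) = t"
proof -
  have "dag (dag a) = a" for a using assms by (simp add: conjugation_def)
  then show ?thesis
    using conjugation_antilinear_antihom [OF assms]
    by (induct t) (simp_all add: conj2_tensor conj_add)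
qed

lemma is_twist_conj2:
  assumes "algebra_hom (counit H)" "conjugation dag" "\<And>a. counit H (dag a) = cnj (counit H a)"
    and "is_twist H F"
  shows "is_twist H (conj2 dag F)"
proof -
  note dag = conjugation_antilinear_antihom [OF assms(2)]
  note add = clinear_add [OF algebra_hom_linear [OF algebra_hom_counit_left [OF assms(1)]]]
    clinear_add [OF algebra_hom_linear [OF algebra_hom_counit_right [OF assms(1)]]]
  have "counit_left (counit H) (conj2 dag t) = dag (counit_left (counit H) t)"
    "counit_right (counit H) (conj2 dag t) = dag (counit_right (counit H) t)" for t
    by (induct t) (simp_all add: conj2_tensor [OF dag] conj_add [OF dag] add
        antilinear_antihom_simps [OF dag] counit_left_tensor [OF assms(1)]
        counit_right_tensor [OF assms(1)] assms(3))
  then show ?thesis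
    using assms(4) antilinear_antihom_invertible [OF antilinear_antihom_conj2 [OF dag]]
    by (simp add: is_twist_def antilinear_antihom_simps(3) [OF dag])
qed

context quasi_hopf_star_algebra
begin

lemma dag_antihom: "antilinear_antihom dag"
  by (rule conjugation_antilinear_antihom [OF conjugation])

lemma is_twist_twisted_canonical:
  assumes "is_twist H F"
  shows "is_twist H (twisted_canonical dag \<Omega> F)"
  unfolding twisted_canonical_def
  by (intro is_twist_mult is_twist_inv is_twist_conj2 counit_hom conjugation counit_conj
      canonical_twist assms)

lemma comult_conj_twisted:
  assumes "is_twist H F"
  shows "conj2 dag (comult (twisted H F) a) =
    twisted_canonical dag \<Omega> F * comult (twisted H F) (dag a) * inv_elem (twisted_canonical dag \<Omega> F)"
proof -
  note conj2 = antilinear_antihom_conj2 [OF dag_antihom]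
  have F: "invertible_elem F" "invertible_elem \<Omega>"
    using assms canonical_twist by (simp_all add: is_twist_def)
  note inv = mult_cancel_middle [OF inv_elem_left [OF F(1)]]
  show ?thesis
    by (simp add: comult_twisted twisted_canonical_def antilinear_antihom_simps(4) [OF conj2]
        antilinear_antihom_inv_elem [OF conj2] antilinear_antihom_invertible [OF conj2] F
        inv_elem_mult inv_elem_inv_elem invertible_elem_mult invertible_elem_inv comult_conj
        mult.assoc inv)
qed

text \<open>
  Both sides are the co-associator of \<open>H\<^sub>\<Omega>\<close> twisted by \<open>(F\<^sup>\<dagger>)\<^sup>-\<^sup>1\<close>: the right-hand side by composition of
  twists, the left-hand side by conjugating the factors of \<open>\<Phi>\<^sub>F\<close> one by one.
\<close>

lemma coassoc_conj_twisted:
  assumes "is_twist H F"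
  shows "inv_elem (conj3 dag (coassoc (twisted H F))) =
    coassoc (twisted (twisted H F) (twisted_canonical dag \<Omega> F))"
proof -
  let ?K = "twisted H \<Omega>" and ?F' = "conj2 dag F"
  note conj2 = antilinear_antihom_conj2 [OF dag_antihom]
  note conj3 = antilinear_antihom_conj3 [OF dag_antihom]
  have F: "invertible_elem F" "invertible_elem \<Omega>"
    using assms canonical_twist by (simp_all add: is_twist_def)
  have F': "is_twist H ?F'"
    by (rule is_twist_conj2 [OF counit_hom conjugation counit_conj assms])
  note homK = algebra_hom_comult_twisted [OF comult_hom canonical_twist]
  have K: "conj2 dag (comult H a) = comult ?K (dag a)" for a
    by (simp add: comult_twisted comult_conj)
  note lin = comult_linear algebra_hom_linear [OF homK]
  note homs = algebra_hom_left_leg algebra_hom_right_leg algebra_hom_comult_left [OF homK]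
    algebra_hom_comult_right [OF homK]
  have "twisted_canonical dag \<Omega> F * F = inv_elem ?F' * \<Omega>"
    by (simp add: twisted_canonical_def mult.assoc inv_elem_left F)
  then have "coassoc (twisted (twisted H F) (twisted_canonical dag \<Omega> F)) =
      coassoc (twisted ?K (inv_elem ?F'))"
    using coassoc_twisted_twisted [OF comult_hom assms is_twist_twisted_canonical [OF assms]]
      coassoc_twisted_twisted [OF comult_hom canonical_twist is_twist_inv [OF counit_hom F']]
    by simp
  also have "\<dots> = left_leg (inv_elem ?F') * comult_left (comult ?K) (inv_elem ?F') *
      inv_elem (conj3 dag (coassoc H)) * tensor_map id (comult ?K) ?F' * right_leg ?F'"
    using F' by (simp add: twisted_coassoc_eq [of ?K] coassoc_conj [symmetric] inv_elem_inv_elem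
        is_twist_def)
  also have "\<dots> = inv_elem (conj3 dag (coassoc (twisted H F)))"
    using F'
    by (simp add: twisted_coassoc_eq [of H F] is_twist_def antilinear_antihom_simps(4) [OF conj3]
        conj3_left_leg [OF dag_antihom] conj3_right_leg [OF dag_antihom]
        conj3_comult_left [OF dag_antihom lin K] conj3_comult_right [OF dag_antihom lin K]
        antilinear_antihom_inv_elem [OF conj2] F homs [THEN algebra_hom_inv_elem]
        homs [THEN algebra_hom_invertible] invertible_elem_inv invertible_elem_mult
        inv_elem_mult inv_elem_inv_elem coassoc_invertible
        antilinear_antihom_invertible [OF conj3] antilinear_antihom_inv_elem [OF conj3] mult.assoc)
  finally show ?thesis by simp
qed

theorem quasi_hopf_star_algebra_twisted:
  assumes "is_twist H F"
  shows "quasi_hopf_star_algebra (twisted H F) dag (twisted_canonical dag \<Omega> F)"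
proof (intro quasi_hopf_star_algebra.intro quasi_hopf_star_algebra_axioms.intro)
  show "quasi_hopf_algebra (twisted H F)" by (rule quasi_hopf_algebra_twisted [OF assms])
  show "conjugation dag" by (rule conjugation)
  show "is_twist (twisted H F) (twisted_canonical dag \<Omega> F)"
    unfolding is_twist_twisted by (rule is_twist_twisted_canonical [OF assms])
  show "counit (twisted H F) (dag a) = cnj (counit (twisted H F) a)" for a
    by (simp add: counit_twisted counit_conj)
qed (rule comult_conj_twisted [OF assms] coassoc_conj_twisted [OF assms])+

lemma self_conjugate_twisted:
  assumes "is_twist H F" "self_conjugate dag \<Omega>"
  shows "self_conjugate dag (twisted_canonical dag \<Omega> F)"
proof -
  note conj2 = antilinear_antihom_conj2 [OF dag_antihom]
  have "invertible_elem F" using assms(1) by (simp add: is_twist_def)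
  then show ?thesis
    using assms(2)
    by (simp add: self_conjugate_def twisted_canonical_def antilinear_antihom_simps(4) [OF conj2]
        antilinear_antihom_inv_elem [OF conj2] antilinear_antihom_invertible [OF conj2]
        conj2_involution [OF conjugation] mult.assoc)
qed

end

theorem theorem1:
  fixes H :: "'a::complex_algebra_1 quasi_hopf"
    and dag :: "'a \<Rightarrow> 'a"
    and \<Omega> F :: "'a \<otimes> 'a"
  assumes "quasi_hopf_star_algebra H dag \<Omega>"
    and "is_twist H F"
  shows "quasi_hopf_star_algebra (twisted H F) dag (twisted_canonical dag \<Omega> F) \<and>
    (self_conjugate dag \<Omega> \<longrightarrow> self_conjugate dag (twisted_canonical dag \<Omega> F)) \<and>
    (star_compatible_antipode H dag \<longrightarrow> star_compatible_antipode (twisted H F) dag)"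
proof -
  interpret quasi_hopf_star_algebra H dag \<Omega> by (rule assms(1))
  show ?thesis
    using quasi_hopf_star_algebra_twisted [OF assms(2)] self_conjugate_twisted [OF assms(2)]
    by (simp add: star_compatible_antipode_def antipode_twisted)
qed

end
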